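(* Let $(S,R)$, $R=\sqrt{h}+\omega$, be a geodesically asymptotically flat Randers manifold with compact set $K$ and ends $E^{(1)},\dots,E^{(m)}$. For $r_0>0$ let $D_{r_0}=K\cup\bigcup_{k}D^{(k)}_{r_0}$, where $D^{(k)}_{r_0}=\{x\in E^{(k)} : |x|^2<r_0^2\}$ in the asymptotic coordinates of the end. Then $\partial D_{r_0}$ is strongly convex (with respect to $R$) for any sufficiently large $r_0$.
   Context: A Randers manifold $(S,R)$ is an $n$-manifold $S$ with a Riemannian metric $h$ and a one-form $\omega$ with $\|\omega\|_x=\sup_{y\in T_xS\setminus\{0\}}|\omega(y)|/\sqrt{h(y,y)}<1$ for all $x\in S$, endowed with the Finsler metric $R(y)=\sqrt{h(y,y)}+\omega(y)$. It is geodesically asymptotically flat if there is a compact set $K\subset S$ such that $S\setminus K$ is a disjoint union of ends $E^{(k)}$, $k=1,\dots,m$, each diffeomorphic to $\mathbb{R}^n\setminus\{0\}$ and admitting an (asymptotic) coordinate chart $x=(x^1,\dots,x^n)$ and constants $p,q>0$ such that, as $|x|\to+\infty$ (with $|x|^2=\sum_i(x^i)^2$), $$h_{ij}=\delta_{ij}+O(1/|x|^p),\qquad \partial_kh_{ij}=O(1/|x|^{p+1}),\qquad \partial_i\omega_j-\partial_j\omega_i=O(1/|x|^{q+1}).$$ For a Finsler metric $F$ and a domain $D$ with $C^2$ boundary, $\partial D$ is strongly convex if at each $x\in\partial D$, for a $C^2$ function $\phi$ on a neighborhood $U$ of $x$ with $\phi^{-1}(0)=U\cap\partial D$, $\phi>0$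 on $U\cap D$, $\mathrm{d}\phi\ne0$ on $U\cap\partial D$, one has $(H_\phi)_y(y,y)<0$ for every $y\in T_x\partial D\setminus\{0\}$. Here $H_\phi$ is the Hessian with respect to the Chern connection, which satisfies $(H_\phi)_{y}(y,y)=(\phi\circ\gamma)''(0)$, where $\gamma$ is the constant-$F$-speed geodesic of $F$ with $\dot\gamma(0)=y$. *)

theory Defs
  imports "HOL-Analysis.Analysis" "HOL-Library.Landau_Symbols"
begin

section \<open>Calculus in coordinates\<close>

text \<open>\<open>C\<^sup>k\<close> maps; the set \<open>S\<close> is meant to be open.\<close>

primrec Ck_on :: "nat \<Rightarrow> (real^'n \<Rightarrow> 'b::real_normed_vector) \<Rightarrow> (real^'n) set \<Rightarrow> bool" where
  "Ck_on 0 f S \<longleftrightarrow> continuous_on S f"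
| "Ck_on (Suc k) f S \<longleftrightarrow> (\<forall>x\<in>S. f differentiable (at x)) \<and>
     (\<forall>v. Ck_on k (\<lambda>x. frechet_derivative f (at x) v) S)"

definition smooth_on :: "(real^'n \<Rightarrow> 'b::real_normed_vector) \<Rightarrow> (real^'n) set \<Rightarrow> bool" where
  "smooth_on f S \<longleftrightarrow> (\<forall>k. Ck_on k f S)"

definition pd :: "'n \<Rightarrow> (real^'n \<Rightarrow> real) \<Rightarrow> real^'n \<Rightarrow> real" where
  "pd i f x = frechet_derivative f (at x) (axis i 1)"

section \<open>Smooth manifolds and tensor fields\<close>

text \<open>The manifold is the whole type \<open>'a\<close>, Hausdorff and second countable by its type class.
  A chart is a pair of its domain and its coordinate map; the values of the map outside the
  domain are irrelevant.\<close>

type_synonym ('a, 'n) chart = "'a set \<times> ('a \<Rightarrow> real^'n)"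

definition chart_inv :: "('a, 'n::finite) chart \<Rightarrow> real^'n \<Rightarrow> 'a" where
  "chart_inv C = inv_into (fst C) (snd C)"

definition is_chart :: "('a::topological_space, 'n::finite) chart \<Rightarrow> bool" where
  "is_chart C \<longleftrightarrow> open (fst C) \<and> open (snd C ` fst C) \<and>
     homeomorphism (fst C) (snd C ` fst C) (snd C) (chart_inv C)"

definition transition :: "('a, 'n::finite) chart \<Rightarrow> ('a, 'n) chart \<Rightarrow> real^'n \<Rightarrow> real^'n" where
  "transition C C' = snd C' \<circ> chart_inv C"

definition compatible :: "('a, 'n::finite) chart \<Rightarrow> ('a, 'n) chart \<Rightarrow> bool" where
  "compatible C C' \<longleftrightarrow>
     smooth_on (transition C C') (snd C ` (fst C \<inter> fst C')) \<and>
     smooth_on (transition C' C) (snd C' ` (fst C \<inter> fst C'))"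

text \<open>A smooth structure is a maximal smooth atlas. In particular a diffeomorphism from an open
  subset of the manifold onto an open subset of \<open>real^'n\<close> is the same thing as a chart
  in the atlas.\<close>

definition smooth_structure ::
  "('a::{t2_space,second_countable_topology}, 'n::finite) chart set \<Rightarrow> bool" where
  "smooth_structure \<A> \<longleftrightarrow>
     (\<Union>C\<in>\<A>. fst C) = UNIV \<and>
     (\<forall>C\<in>\<A>. is_chart C) \<and>
     (\<forall>C\<in>\<A>. \<forall>C'\<in>\<A>. compatible C C') \<and>
     (\<forall>C. is_chart C \<and> (\<forall>C'\<in>\<A>. compatible C C') \<longrightarrow> C \<in> \<A>)"

text \<open>Tangent vectors are written in components with respect to a chart, and tensor fields are
  families of component functions (one for each chart of the atlas, as functions of the
  coordinates) obeying the tensorial transformation law.\<close>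

type_synonym ('a, 'n) metric_field = "('a, 'n) chart \<Rightarrow> real^'n \<Rightarrow> real^'n^'n"
type_synonym ('a, 'n) covector_field = "('a, 'n) chart \<Rightarrow> real^'n \<Rightarrow> real^'n"

definition riemannian_metric ::
  "('a, 'n::finite) chart set \<Rightarrow> ('a, 'n) metric_field \<Rightarrow> bool" where
  "riemannian_metric \<A> h \<longleftrightarrow>
     (\<forall>C\<in>\<A>. smooth_on (h C) (snd C ` fst C) \<and>
        (\<forall>x \<in> snd C ` fst C. transpose (h C x) = h C x \<and>
           (\<forall>v. v \<noteq> 0 \<longrightarrow> v \<bullet> (h C x *v v) > 0))) \<and>
     (\<forall>C\<in>\<A>. \<forall>C'\<in>\<A>. \<forall>x \<in> snd C ` (fst C \<inter> fst C').
        let T = frechet_derivative (transition C C') (at x) in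
        \<forall>v w. v \<bullet> (h C x *v w) = T v \<bullet> (h C' (transition C C' x) *v T w))"

definition one_form ::
  "('a, 'n::finite) chart set \<Rightarrow> ('a, 'n) covector_field \<Rightarrow> bool" where
  "one_form \<A> \<omega> \<longleftrightarrow>
     (\<forall>C\<in>\<A>. smooth_on (\<omega> C) (snd C ` fst C)) \<and>
     (\<forall>C\<in>\<A>. \<forall>C'\<in>\<A>. \<forall>x \<in> snd C ` (fst C \<inter> fst C').
        let T = frechet_derivative (transition C C') (at x) in
        \<forall>v. \<omega> C x \<bullet> v = \<omega> C' (transition C C' x) \<bullet> T v)"

definition covector_norm :: "real^'n^'n \<Rightarrow> real^'n \<Rightarrow> real" where
  "covector_norm H w = (SUP y\<in>UNIV - {0}. \<bar>w \<bullet> y\<bar> / sqrt (y \<bullet> (H *v y)))"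

definition randers_manifold ::
  "('a::{t2_space,second_countable_topology}, 'n::finite) chart set \<Rightarrow>
     ('a, 'n) metric_field \<Rightarrow> ('a, 'n) covector_field \<Rightarrow> bool" where
  "randers_manifold \<A> h \<omega> \<longleftrightarrow>
     smooth_structure \<A> \<and> riemannian_metric \<A> h \<and> one_form \<A> \<omega> \<and>
     (\<forall>C\<in>\<A>. \<forall>x \<in> snd C ` fst C. covector_norm (h C x) (\<omega> C x) < 1)"

text \<open>A Finsler metric is given in each chart as a function of position and velocity.\<close>

type_synonym ('a, 'n) finsler_metric = "('a, 'n) chart \<Rightarrow> real^'n \<Rightarrow> real^'n \<Rightarrow> real"

definition randers_metric ::
  "('a, 'n::finite) metric_field \<Rightarrow> ('a, 'n) covector_field \<Rightarrow> ('a, 'n) finsler_metric" where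
  "randers_metric h \<omega> C x y = sqrt (y \<bullet> (h C x *v y)) + \<omega> C x \<bullet> y"

section \<open>The Chern connection in local coordinates\<close>

text \<open>Throughout this section \<open>F x y\<close> is a Finsler metric in one chart.
  \<open>fund_tensor\<close>: \<open>g\<^sub>i\<^sub>j = 1/2 \<partial>\<^sup>2F\<^sup>2 / \<partial>y\<^sup>i\<partial>y\<^sup>j\<close>;
  \<open>formal_christoffel\<close>: \<open>\<gamma>\<^sup>i\<^sub>j\<^sub>k\<close>, the Christoffel symbols of \<open>g\<close> with respect to position only;
  \<open>cartan_tensor\<close>: \<open>C\<^sub>i\<^sub>j\<^sub>k = 1/2 \<partial>g\<^sub>i\<^sub>j / \<partial>y\<^sup>k\<close>;
  \<open>nonlinear_connection\<close>: \<open>N\<^sup>i\<^sub>j = \<gamma>\<^sup>i\<^sub>j\<^sub>k y\<^sup>k - C\<^sup>i\<^sub>j\<^sub>k \<gamma>\<^sup>k\<^sub>r\<^sub>s y\<^sup>r y\<^sup>s\<close>;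
  \<open>horizontal_pd\<close>: \<open>\<delta>g\<^sub>i\<^sub>j / \<delta>x\<^sup>k\<close> where \<open>\<delta>/\<delta>x\<^sup>k = \<partial>/\<partial>x\<^sup>k - N\<^sup>m\<^sub>k \<partial>/\<partial>y\<^sup>m\<close>;
  \<open>chern\<close>: the coefficients \<open>\<Gamma>\<^sup>i\<^sub>j\<^sub>k\<close> of the Chern connection.\<close>

definition fund_tensor :: "(real^'n \<Rightarrow> real^'n \<Rightarrow> real) \<Rightarrow> real^'n \<Rightarrow> real^'n \<Rightarrow> real^'n^'n" where
  "fund_tensor F x y = (\<chi> i j. 1/2 * pd i (pd j (\<lambda>v. (F x v)\<^sup>2)) y)"

definition fund_inv :: "(real^'n \<Rightarrow> real^'n \<Rightarrow> real) \<Rightarrow> real^'n \<Rightarrow> real^'n \<Rightarrow> real^'n^'n" where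
  "fund_inv F x y = matrix_inv (fund_tensor F x y)"

definition formal_christoffel ::
  "(real^'n \<Rightarrow> real^'n \<Rightarrow> real) \<Rightarrow> 'n \<Rightarrow> 'n \<Rightarrow> 'n \<Rightarrow> real^'n \<Rightarrow> real^'n \<Rightarrow> real" where
  "formal_christoffel F i j k x y = 1/2 * (\<Sum>s\<in>UNIV. fund_inv F x y $ i $ s *
     (pd k (\<lambda>x. fund_tensor F x y $ s $ j) x
      + pd j (\<lambda>x. fund_tensor F x y $ s $ k) x
      - pd s (\<lambda>x. fund_tensor F x y $ j $ k) x))"

definition cartan_tensor ::
  "(real^'n \<Rightarrow> real^'n \<Rightarrow> real) \<Rightarrow> 'n \<Rightarrow> 'n \<Rightarrow> 'n \<Rightarrow> real^'n \<Rightarrow> real^'n \<Rightarrow> real" where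
  "cartan_tensor F i j k x y = 1/2 * pd k (\<lambda>y. fund_tensor F x y $ i $ j) y"

definition nonlinear_connection ::
  "(real^'n \<Rightarrow> real^'n \<Rightarrow> real) \<Rightarrow> 'n \<Rightarrow> 'n \<Rightarrow> real^'n \<Rightarrow> real^'n \<Rightarrow> real" where
  "nonlinear_connection F i j x y =
     (\<Sum>k\<in>UNIV. formal_christoffel F i j k x y * y $ k)
     - (\<Sum>k\<in>UNIV. \<Sum>l\<in>UNIV. fund_inv F x y $ i $ l * cartan_tensor F l j k x y *
          (\<Sum>r\<in>UNIV. \<Sum>s\<in>UNIV. formal_christoffel F k r s x y * y $ r * y $ s))"

definition horizontal_pd ::
  "(real^'n \<Rightarrow> real^'n \<Rightarrow> real) \<Rightarrow> 'n \<Rightarrow> 'n \<Rightarrow> 'n \<Rightarrow> real^'n \<Rightarrow> real^'n \<Rightarrow> real" where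
  "horizontal_pd F k i j x y = pd k (\<lambda>x. fund_tensor F x y $ i $ j) x
     - (\<Sum>m\<in>UNIV. nonlinear_connection F m k x y * pd m (\<lambda>y. fund_tensor F x y $ i $ j) y)"

definition chern ::
  "(real^'n \<Rightarrow> real^'n \<Rightarrow> real) \<Rightarrow> 'n \<Rightarrow> 'n \<Rightarrow> 'n \<Rightarrow> real^'n \<Rightarrow> real^'n \<Rightarrow> real" where
  "chern F i j k x y = 1/2 * (\<Sum>s\<in>UNIV. fund_inv F x y $ i $ s *
     (horizontal_pd F k s j x y + horizontal_pd F j s k x y - horizontal_pd F s j k x y))"

text \<open>The Hessian \<open>(H\<^sub>f)\<^sub>y(u,v) = u(v(f)) - (D\<^sup>y\<^sub>u v)(f)\<close> of a function \<open>f\<close> of the coordinates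
  at \<open>x\<close>, with reference vector \<open>y\<close>.\<close>

definition chern_hessian ::
  "(real^'n \<Rightarrow> real^'n \<Rightarrow> real) \<Rightarrow> (real^'n \<Rightarrow> real) \<Rightarrow>
     real^'n \<Rightarrow> real^'n \<Rightarrow> real^'n \<Rightarrow> real^'n \<Rightarrow> real" where
  "chern_hessian F f x y u v = (\<Sum>i\<in>UNIV. \<Sum>j\<in>UNIV. u $ i * v $ j *
     (pd i (pd j f) x - (\<Sum>k\<in>UNIV. chern F k i j x y * pd k f x)))"

section \<open>Strong convexity\<close>

definition Ck_function ::
  "nat \<Rightarrow> ('a, 'n::finite) chart set \<Rightarrow> 'a set \<Rightarrow> ('a \<Rightarrow> real) \<Rightarrow> bool" where
  "Ck_function k \<A> U \<phi> \<longleftrightarrow>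
     (\<forall>p\<in>U. \<exists>C\<in>\<A>. p \<in> fst C \<and> Ck_on k (\<phi> \<circ> chart_inv C) (snd C ` (U \<inter> fst C)))"

definition chart_differential ::
  "('a, 'n::finite) chart \<Rightarrow> ('a \<Rightarrow> real) \<Rightarrow> 'a \<Rightarrow> real^'n \<Rightarrow> real" where
  "chart_differential C \<phi> p = frechet_derivative (\<phi> \<circ> chart_inv C) (at (snd C p))"

text \<open>Domains are open and connected. Since the ambient manifold is not assumed to be connected,
  connectedness is only demanded when it is.\<close>

definition manifold_domain :: "'a::topological_space set \<Rightarrow> bool" where
  "manifold_domain D \<longleftrightarrow> open D \<and> (connected (UNIV::'a set) \<longrightarrow> connected D)"

text \<open>The existence of a defining function \<open>\<phi>\<close> around every boundary point expresses that the
  boundary is \<open>C\<^sup>2\<close>, and its tangent space at \<open>p\<close> is then the kernel of the differential of \<open>\<phi>\<close>.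
  Whether the differential vanishes, and the Chern Hessian, do not depend on the chart
  around the point.\<close>

definition strongly_convex_boundary ::
  "('a::topological_space, 'n::finite) chart set \<Rightarrow> ('a, 'n) finsler_metric \<Rightarrow> 'a set \<Rightarrow> bool" where
  "strongly_convex_boundary \<A> F D \<longleftrightarrow> manifold_domain D \<and>
     (\<forall>p \<in> frontier D. \<exists>U \<phi>. open U \<and> p \<in> U \<and> Ck_function 2 \<A> U \<phi> \<and>
        {q \<in> U. \<phi> q = 0} = U \<inter> frontier D \<and>
        (\<forall>q \<in> U \<inter> D. \<phi> q > 0) \<and>
        (\<forall>q \<in> U \<inter> frontier D. \<exists>C\<in>\<A>. q \<in> fst C \<and> (\<exists>v. chart_differential C \<phi> q v \<noteq> 0)) \<and>
        (\<exists>C\<in>\<A>. p \<in> fst C \<and>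
           (\<forall>y. y \<noteq> 0 \<and> chart_differential C \<phi> p y = 0 \<longrightarrow>
              chern_hessian (F C) (\<phi> \<circ> chart_inv C) (snd C p) y y y < 0)))"

section \<open>Geodesic asymptotic flatness\<close>

definition asymptotic_chart ::
  "('a, 'n::finite) metric_field \<Rightarrow> ('a, 'n) covector_field \<Rightarrow> ('a, 'n) chart \<Rightarrow> bool" where
  "asymptotic_chart h \<omega> C \<longleftrightarrow>
     (\<forall>\<^sub>F x in at_infinity. x \<in> snd C ` fst C) \<and>
     (\<exists>p>0. \<exists>q>0. \<forall>i j k.
        (\<lambda>x. h C x $ i $ j - (if i = j then 1 else 0)) \<in> O[at_infinity](\<lambda>x. 1 / norm x powr p) \<and>
        (\<lambda>x. pd k (\<lambda>x. h C x $ i $ j) x) \<in> O[at_infinity](\<lambda>x. 1 / norm x powr (p + 1)) \<and>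
        (\<lambda>x. pd i (\<lambda>x. \<omega> C x $ j) x - pd j (\<lambda>x. \<omega> C x $ i) x)
          \<in> O[at_infinity](\<lambda>x. 1 / norm x powr (q + 1)))"

text \<open>\<open>X k\<close> is the asymptotic chart of the \<open>k\<close>-th end, whose domain \<open>fst (X k)\<close> is the end itself.
  Its image need only contain a neighbourhood of infinity (such as the complement of
  the origin or of a ball).\<close>

definition geodesically_asymptotically_flat ::
  "('a::topological_space, 'n::finite) chart set \<Rightarrow> ('a, 'n) metric_field \<Rightarrow>
     ('a, 'n) covector_field \<Rightarrow> 'a set \<Rightarrow> nat \<Rightarrow> (nat \<Rightarrow> ('a, 'n) chart) \<Rightarrow> bool" where
  "geodesically_asymptotically_flat \<A> h \<omega> K m X \<longleftrightarrow>
     compact K \<and>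
     - K = (\<Union>k\<in>{1..m}. fst (X k)) \<and>
     disjoint_family_on (\<lambda>k. fst (X k)) {1..m} \<and>
     (\<forall>k\<in>{1..m}. X k \<in> \<A> \<and>
        (\<exists>C\<in>\<A>. fst C = fst (X k) \<and> snd C ` fst C = UNIV - {0}) \<and>
        asymptotic_chart h \<omega> (X k))"

definition asymptotic_domain ::
  "'a set \<Rightarrow> nat \<Rightarrow> (nat \<Rightarrow> ('a, 'n::finite) chart) \<Rightarrow> real \<Rightarrow> 'a set" where
  "asymptotic_domain K m X r =
     K \<union> (\<Union>k\<in>{1..m}. {p \<in> fst (X k). (norm (snd (X k) p))\<^sup>2 < r\<^sup>2})"

end

theory Submission
  imports Defs
begin

text \<open>Fix an end with its asymptotic coordinates and let \<open>\<phi> = r\<^sup>2 - |x|\<^sup>2\<close>. At a point with \<open>|x| = r\<close> and for a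
  vector \<open>y\<close> with \<open>x \<bullet> y = 0\<close> the Hessian of \<open>\<phi>\<close> is \<open>- 2 |y|\<^sup>2 + 2 x \<bullet> Z\<close>, where
  \<open>Z\<^sup>k = \<Gamma>\<^sup>k\<^sub>i\<^sub>j y\<^sup>i y\<^sup>j\<close> is the spray of the Randers metric \<open>F = \<alpha> + \<omega>\<close>. The nonlinear connection drops out of
  this contraction, because the Cartan tensor vanishes when contracted with \<open>y\<close>
  (\<open>cartan_homogeneous\<close>, \<open>chern_contract\<close>), and a computation with the explicit fundamental tensor gives
  \<open>Z = h\<^sup>-\<^sup>1 (A + \<alpha> B) + c y\<close> for a scalar \<open>c\<close> (\<open>spray\<close>). Here \<open>A\<close> consists of the Christoffel symbols of the
  first kind of \<open>h\<close>, contracted with \<open>y\<close>, and \<open>B\<close> is \<open>d\<omega>\<close> contracted with \<open>y\<close>. The term \<open>c y\<close> is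
  tangent to the sphere and does not contribute; this is why no bound on the symmetrized
  derivatives of \<open>\<omega>\<close> and no uniform gap between its norm and one is needed. The decay of \<open>\<partial>h\<close> and \<open>d\<omega>\<close> makes
  \<open>x \<bullet> h\<^sup>-\<^sup>1 (A + \<alpha> B)\<close> smaller than \<open>|y|\<^sup>2\<close> for large \<open>|x|\<close>, so that the Hessian is negative
  (\<open>hessian_neg\<close>).

  It remains to see that the domain is open, that it is connected when the manifold is, and that its
  boundary consists of the coordinate spheres. The essential point is that the set \<open>|x| \<ge> r\<close> of an end is closed in
  the whole manifold: as \<open>h\<close> is comparable to the Euclidean metric, points far out in the end cannot
  accumulate outside of the end (\<open>end_far_part_closed\<close>). Connectedness then follows by a radial
  retraction (\<open>connected_sublevel\<close>).\<close>

section \<open>Derivatives in coordinates\<close>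

lemma pd_eq_has_derivative:
  assumes "(f has_derivative f') (at x)"
  shows "pd i f x = f' (axis i 1)"
  unfolding pd_def frechet_derivative_at[OF assms, symmetric] by (rule refl)

lemma has_derivative_cong_open:
  assumes S: "open S" "x \<in> S" and eq: "\<And>z. z \<in> S \<Longrightarrow> f z = g z"
  shows "(f has_derivative D) (at x) \<longleftrightarrow> (g has_derivative D) (at x)"
  by (intro iffI; erule has_derivative_transform_within_open[OF _ S]) (simp_all add: eq)

lemma frechet_derivative_cong_open:
  assumes "open S" "x \<in> S" "\<And>z. z \<in> S \<Longrightarrow> f z = g z"
  shows "frechet_derivative f (at x) = frechet_derivative g (at x)"
proof -
  have "(\<lambda>D. (f has_derivative D) (at x)) = (\<lambda>D. (g has_derivative D) (at x))"
    by (intro ext has_derivative_cong_open[OF assms])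
  then show ?thesis by (simp only: frechet_derivative_def)
qed

lemma pd_cong_open:
  assumes "open S" "x \<in> S" "\<And>z. z \<in> S \<Longrightarrow> f z = g z"
  shows "pd i f x = pd i g x"
  using frechet_derivative_cong_open[OF assms] by (simp add: pd_def)

section \<open>The Randers norm on a vector space\<close>

text \<open>The pointwise data of a Randers metric in a chart: a positive definite symmetric matrix \<open>H\<close>
  and a covector \<open>b\<close>.\<close>

definition pos_sym :: "real^'n^'n \<Rightarrow> bool" where
  "pos_sym H \<longleftrightarrow> transpose H = H \<and> (\<forall>v. v \<noteq> 0 \<longrightarrow> v \<bullet> (H *v v) > 0)"

text \<open>The norm of \<open>H\<close>, written \<open>\<alpha>\<close> below, and the Randers norm \<open>F = \<alpha> + b\<close>.\<close>

definition hnorm :: "real^'n^'n \<Rightarrow> real^'n \<Rightarrow> real" where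
  "hnorm H y = sqrt (y \<bullet> (H *v y))"

definition randers_norm :: "real^'n^'n \<Rightarrow> real^'n \<Rightarrow> real^'n \<Rightarrow> real" where
  "randers_norm H b y = hnorm H y + b \<bullet> y"

text \<open>The differential \<open>L = H y / \<alpha> + b\<close> of the Randers norm at \<open>y\<close>.\<close>

definition randers_diff :: "real^'n^'n \<Rightarrow> real^'n \<Rightarrow> real^'n \<Rightarrow> real^'n" where
  "randers_diff H b y = (1 / hnorm H y) *\<^sub>R (H *v y) + b"

text \<open>The fundamental tensor \<open>g\<^sub>i\<^sub>j = L\<^sub>i L\<^sub>j + (F/\<alpha>) (H\<^sub>i\<^sub>j - l\<^sub>i l\<^sub>j)\<close>, where \<open>l = H y / \<alpha>\<close>, in closed form;
  that it is half the second derivative of \<open>F\<^sup>2\<close> away from \<open>y = 0\<close> is shown in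
  \<open>fund_tensor_randers\<close>.\<close>

definition randers_tensor :: "real^'n^'n \<Rightarrow> real^'n \<Rightarrow> real^'n \<Rightarrow> real^'n^'n" where
  "randers_tensor H b y = (\<chi> i j. randers_diff H b y $ i * randers_diff H b y $ j
     + randers_norm H b y / hnorm H y * (H $ i $ j - (H *v y) $ i * (H *v y) $ j / (hnorm H y)\<^sup>2))"

lemma pos_sym_nth: "pos_sym H \<Longrightarrow> H $ i $ j = H $ j $ i"
  unfolding pos_sym_def by (metis transpose_def vec_lambda_beta)

lemma symmetric_inner:
  fixes A :: "real^'n^'n"
  assumes "\<And>i j. A $ i $ j = A $ j $ i"
  shows "v \<bullet> (A *v w) = (A *v v) \<bullet> w"
proof -
  have "transpose A = A" by (simp add: vec_eq_iff transpose_def assms[of _ _])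
  then show ?thesis by (metis dot_lmul_matrix transpose_matrix_vector)
qed

lemma pos_sym_inner: "pos_sym H \<Longrightarrow> v \<bullet> (H *v w) = (H *v v) \<bullet> w"
  by (rule symmetric_inner) (rule pos_sym_nth)

lemma hnorm_pos: "pos_sym H \<Longrightarrow> y \<noteq> 0 \<Longrightarrow> hnorm H y > 0"
  by (simp add: hnorm_def pos_sym_def)

lemma hnorm_square: "pos_sym H \<Longrightarrow> (hnorm H y)\<^sup>2 = y \<bullet> (H *v y)"
  by (cases "y = 0") (auto simp: hnorm_def pos_sym_def less_imp_le)

lemma has_derivative_matrix_vector: "((*v) H has_derivative (*v) H) (at (y::real^'n))"
  by (intro bounded_linear_imp_has_derivative)
     (simp add: matrix_vector_mul_linear linear_conv_bounded_linear[symmetric])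

lemma has_derivative_hnorm:
  assumes "pos_sym H" "y \<noteq> 0"
  shows "(hnorm H has_derivative (\<lambda>w. ((H *v y) \<bullet> w) / hnorm H y)) (at y)"
proof -
  have pos: "y \<bullet> (H *v y) > 0" using assms by (simp add: pos_sym_def)
  have "((\<lambda>y. y \<bullet> (H *v y)) has_derivative (\<lambda>w. y \<bullet> (H *v w) + w \<bullet> (H *v y))) (at y)"
    by (intro has_derivative_inner has_derivative_ident has_derivative_matrix_vector)
  also have "(\<lambda>w. y \<bullet> (H *v w) + w \<bullet> (H *v y)) = (\<lambda>w. 2 * ((H *v y) \<bullet> w))"
    by (simp add: fun_eq_iff pos_sym_inner[OF assms(1), of y] inner_commute)
  finally have A: "((\<lambda>y. y \<bullet> (H *v y)) has_derivative (\<lambda>w. 2 * ((H *v y) \<bullet> w))) (at y)" .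
  have B: "((\<lambda>y. sqrt (y \<bullet> (H *v y))) has_derivative
      (\<lambda>w. 2 * ((H *v y) \<bullet> w) * (inverse (sqrt (y \<bullet> (H *v y))) / 2))) (at y)"
    by (rule has_derivative_real_sqrt[OF _ A]) (fact pos)
  have eq: "a / s = 2 * a * (inverse s / 2)" for a s :: real
    by (simp add: inverse_eq_divide)
  show ?thesis using B unfolding hnorm_def[abs_def] eq[symmetric] .
qed

lemma has_derivative_randers_norm:
  assumes "pos_sym H" "y \<noteq> 0"
  shows "(randers_norm H b has_derivative (\<lambda>w. randers_diff H b y \<bullet> w)) (at y)"
  unfolding randers_norm_def[abs_def]
  by (rule derivative_eq_intros has_derivative_hnorm[OF assms] refl)+
     (simp add: fun_eq_iff randers_diff_def inner_left_distrib)

lemma has_derivative_vec_nth: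
  assumes "(f has_derivative f') F"
  shows "((\<lambda>x. f x $ s) has_derivative (\<lambda>w. f' w $ s)) F"
  using bounded_linear.has_derivative[OF bounded_linear_vec_nth assms] .

lemma has_derivative_randers_diff:
  assumes "pos_sym H" "y \<noteq> 0"
  shows "((\<lambda>y. randers_diff H b y $ s) has_derivative
    (\<lambda>w. ((H *v w) $ s - (H *v y) $ s * ((H *v y) \<bullet> w) / (hnorm H y)\<^sup>2) / hnorm H y)) (at y)"
proof -
  have *: "(\<lambda>y. randers_diff H b y $ s) = (\<lambda>y. (H *v y) $ s / hnorm H y + b $ s)"
    by (simp add: fun_eq_iff randers_diff_def)
  have nz: "hnorm H y \<noteq> 0" using hnorm_pos[OF assms] by simp
  have "((\<lambda>y. (H *v y) $ s / hnorm H y + b $ s) has_derivative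
    (\<lambda>w. ((H *v w) $ s * hnorm H y - (H *v y) $ s * (((H *v y) \<bullet> w) / hnorm H y))
           / (hnorm H y * hnorm H y) + 0)) (at y)"
    by (intro has_derivative_add has_derivative_const has_derivative_divide' nz has_derivative_hnorm[OF assms]
       has_derivative_vec_nth has_derivative_matrix_vector)
  moreover have "((H *v w) $ s * hnorm H y - (H *v y) $ s * (((H *v y) \<bullet> w) / hnorm H y))
           / (hnorm H y * hnorm H y) + 0
     = ((H *v w) $ s - (H *v y) $ s * ((H *v y) \<bullet> w) / (hnorm H y)\<^sup>2) / hnorm H y" for w
    using nz by (simp add: power2_eq_square diff_divide_distrib)
  ultimately show ?thesis unfolding * by simp
qed

lemma matrix_vector_axis_nth: "(H *v axis i 1) $ s = (H::real^'n^'n) $ s $ i"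
  by (simp add: matrix_vector_mul_component inner_axis)

lemma randers_tensor_apply:
  "(randers_tensor H b y *v w) $ s = (randers_diff H b y \<bullet> w) * randers_diff H b y $ s
     + randers_norm H b y / hnorm H y * ((H *v w) $ s - ((H *v y) \<bullet> w) / (hnorm H y)\<^sup>2 * (H *v y) $ s)"
proof -
  have r: "row s (randers_tensor H b y) = randers_diff H b y $ s *\<^sub>R randers_diff H b y +
      (randers_norm H b y / hnorm H y) *\<^sub>R (row s H - ((H *v y) $ s / (hnorm H y)\<^sup>2) *\<^sub>R (H *v y))"
    by (simp add: vec_eq_iff row_def randers_tensor_def)
  have "(randers_tensor H b y *v w) $ s = row s (randers_tensor H b y) \<bullet> w"
    by (simp add: matrix_vector_mul_component row_def vec_nth_inverse)
  also have "\<dots> = randers_diff H b y $ s * (randers_diff H b y \<bullet> w) +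
      (randers_norm H b y / hnorm H y) * ((H *v w) $ s - ((H *v y) $ s / (hnorm H y)\<^sup>2) * ((H *v y) \<bullet> w))"
    unfolding r by (simp add: inner_left_distrib inner_diff_left matrix_vector_mul_component row_def vec_nth_inverse)
  finally show ?thesis by (simp add: mult_ac)
qed

text \<open>\<open>F L\<close> is half the gradient of \<open>F\<^sup>2\<close>, so its derivative is the fundamental tensor.\<close>

lemma has_derivative_norm_times_diff:
  assumes "pos_sym H" "y \<noteq> 0"
  shows "((\<lambda>v. randers_norm H b v * randers_diff H b v $ s) has_derivative
    (\<lambda>w. (randers_tensor H b y *v w) $ s)) (at y)"
proof -
  have 1: "((\<lambda>v. randers_norm H b v * randers_diff H b v $ s) has_derivative
    (\<lambda>w. randers_norm H b y * (((H *v w) $ s - (H *v y) $ s * ((H *v y) \<bullet> w) / (hnorm H y)\<^sup>2) / hnorm H y)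
       + (randers_diff H b y \<bullet> w) * randers_diff H b y $ s)) (at y)"
    by (intro has_derivative_mult has_derivative_randers_norm[OF assms] has_derivative_randers_diff[OF assms])
  have 2: "(randers_tensor H b y *v w) $ s = randers_norm H b y * (((H *v w) $ s - (H *v y) $ s * ((H *v y) \<bullet> w) / (hnorm H y)\<^sup>2) / hnorm H y)
       + (randers_diff H b y \<bullet> w) * randers_diff H b y $ s" for w
    unfolding randers_tensor_apply by (simp add: mult_ac)
  show ?thesis using 1 unfolding 2 .
qed

lemma fund_tensor_randers:
  assumes "pos_sym (H x)" "y \<noteq> 0"
  shows "fund_tensor (\<lambda>x. randers_norm (H x) (b x)) x y = randers_tensor (H x) (b x) y"
proof -
  let ?f = "randers_norm (H x) (b x)" let ?L = "randers_diff (H x) (b x)"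
  have 1: "pd j (\<lambda>v. (?f v)\<^sup>2) v = 2 * (?f v * ?L v $ j)" if "v \<noteq> 0" for j v
  proof -
    have "((\<lambda>v. (?f v)\<^sup>2) has_derivative (\<lambda>w. 2 * (?f v * (?L v \<bullet> w)))) (at v)"
      by (rule derivative_eq_intros has_derivative_randers_norm[OF assms(1) that] refl)+
         (simp add: fun_eq_iff)
    from pd_eq_has_derivative[OF this] show ?thesis by (simp add: inner_axis)
  qed
  have 2: "pd i (pd j (\<lambda>v. (?f v)\<^sup>2)) y = 2 * randers_tensor (H x) (b x) y $ j $ i" for i j
  proof -
    have "pd i (pd j (\<lambda>v. (?f v)\<^sup>2)) y = pd i (\<lambda>v. 2 * (?f v * ?L v $ j)) y"
      by (rule pd_cong_open[of "- {0}"]) (use assms 1 in auto)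
    also have "((\<lambda>v. 2 * (?f v * ?L v $ j)) has_derivative
      (\<lambda>w. 2 * (randers_tensor (H x) (b x) y *v w) $ j)) (at y)"
      by (rule has_derivative_mult_right has_derivative_norm_times_diff assms)+
    from pd_eq_has_derivative[OF this] have "pd i (\<lambda>v. 2 * (?f v * ?L v $ j)) y = 2 * randers_tensor (H x) (b x) y $ j $ i"
      by (simp add: matrix_vector_axis_nth)
    finally show ?thesis .
  qed
  show ?thesis
    by (simp add: vec_eq_iff fund_tensor_def 2)
       (simp add: randers_tensor_def pos_sym_nth[OF assms(1)] mult_ac)
qed

lemma randers_tensor_sym: "pos_sym H \<Longrightarrow> randers_tensor H b y $ i $ j = randers_tensor H b y $ j $ i"
  using pos_sym_nth[of H i j] by (simp add: randers_tensor_def mult_ac)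


lemma randers_diff_self:
  assumes "pos_sym H" "y \<noteq> 0"
  shows "randers_diff H b y \<bullet> y = randers_norm H b y"
proof -
  have "(H *v y) \<bullet> y = hnorm H y * hnorm H y"
    by (simp add: hnorm_square[OF assms(1)] inner_commute flip: power2_eq_square)
  then show ?thesis
    using hnorm_pos[OF assms] by (simp add: randers_diff_def randers_norm_def inner_left_distrib)
qed

text \<open>Euler's relation \<open>g y = F L\<close>.\<close>

lemma randers_tensor_self:
  assumes "pos_sym H" "y \<noteq> 0"
  shows "randers_tensor H b y *v y = randers_norm H b y *\<^sub>R randers_diff H b y"
proof -
  have "(H *v y) \<bullet> y = (hnorm H y)\<^sup>2"
    by (simp add: hnorm_square[OF assms(1)] inner_commute)
  then show ?thesis
    using hnorm_pos[OF assms] by (simp add: vec_eq_iff randers_tensor_apply randers_diff_self[OF assms])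
qed

lemma differentiable_randers_tensor:
  assumes "pos_sym H" "y \<noteq> 0"
  shows "(\<lambda>y. randers_tensor H b y $ s $ i) differentiable (at y)"
proof -
  have *: "(\<lambda>y. randers_tensor H b y $ s $ i) = (\<lambda>y. randers_diff H b y $ s * randers_diff H b y $ i
     + randers_norm H b y / hnorm H y * (H $ s $ i - (H *v y) $ s * (H *v y) $ i / (hnorm H y)\<^sup>2))"
    by (simp add: randers_tensor_def)
  show ?thesis unfolding * using hnorm_pos[OF assms]
    by (intro derivative_intros differentiable_divide
       differentiableI[OF has_derivative_randers_diff[OF assms]]
       differentiableI[OF has_derivative_randers_norm[OF assms]]
       differentiableI[OF has_derivative_hnorm[OF assms]] differentiableI[OF has_derivative_vec_nth[OF has_derivative_matrix_vector]]) auto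
qed

text \<open>Nondegeneracy of \<open>g\<close> only needs \<open>F(y) \<noteq> 0\<close>: if \<open>g w = 0\<close>, then pairing with \<open>y\<close> gives \<open>L(w) = 0\<close>,
  so \<open>w\<close> is a multiple of \<open>y\<close>, and \<open>L(y) = F(y)\<close> forces the multiple to be zero.\<close>

lemma randers_tensor_inj:
  assumes "pos_sym H" "y \<noteq> 0" "randers_norm H b y \<noteq> 0" and 0: "randers_tensor H b y *v w = 0"
  shows "w = 0"
proof -
  let ?L = "randers_diff H b y"
  have "y \<bullet> (randers_tensor H b y *v w) = (randers_tensor H b y *v y) \<bullet> w"
    using randers_tensor_sym[OF assms(1)] by (rule symmetric_inner)
  then have L: "?L \<bullet> w = 0"
    using 0 assms by (simp add: randers_tensor_self)
  define c where "c = ((H *v y) \<bullet> w) / (hnorm H y)\<^sup>2"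
  have "H *v w - c *\<^sub>R (H *v y) = 0"
    unfolding vec_eq_iff
  proof
    fix s
    have "(randers_tensor H b y *v w) $ s = 0" using 0 by simp
    then show "(H *v w - c *\<^sub>R (H *v y)) $ s = 0 $ s"
      using assms(3) hnorm_pos[OF assms(1,2)] unfolding randers_tensor_apply L c_def by simp
  qed
  then have "H *v (w - c *\<^sub>R y) = 0"
    by (simp add: matrix_vector_mult_diff_distrib matrix_vector_mult_scaleR)
  then have w: "w = c *\<^sub>R y"
    using assms(1) unfolding pos_sym_def by (metis inner_zero_right less_irrefl right_minus_eq)
  then have "c * randers_norm H b y = 0"
    using L by (simp add: randers_diff_self[OF assms(1,2)])
  then show ?thesis using w assms by simp
qed

lemma randers_tensor_inv:
  assumes "pos_sym H" "y \<noteq> 0" "randers_norm H b y \<noteq> 0"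
  shows "matrix_inv (randers_tensor H b y) *v (randers_tensor H b y *v w) = w"
proof -
  have "invertible (randers_tensor H b y)"
    using randers_tensor_inj[OF assms] by (auto simp: invertible_left_inverse matrix_left_invertible_ker)
  then have "matrix_inv (randers_tensor H b y) ** randers_tensor H b y = mat 1"
    unfolding invertible_def matrix_inv_def by (rule someI2_ex) simp
  then show ?thesis
    by (simp add: matrix_vector_mul_assoc)
qed

text \<open>The Cartan tensor vanishes when contracted with \<open>y\<close>, since \<open>g\<close> is homogeneous of degree zero.
  The proof differentiates Euler's relation \<open>g y = F L\<close>.\<close>

lemma cartan_homogeneous:
  assumes "pos_sym H" "y \<noteq> 0"
  shows "(\<Sum>i\<in>UNIV. y $ i * pd m (\<lambda>v. randers_tensor H b v $ s $ i) y) = 0"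
proof -
  let ?g = "randers_tensor H b"
  have "((\<lambda>v. v $ i) has_derivative (\<lambda>w. w $ i)) (at y)" for i
    by (intro bounded_linear_imp_has_derivative bounded_linear_vec_nth)
  then have 1: "((\<lambda>v. \<Sum>i\<in>UNIV. v $ i * ?g v $ s $ i) has_derivative
      (\<lambda>w. \<Sum>i\<in>UNIV. y $ i * frechet_derivative (\<lambda>v. ?g v $ s $ i) (at y) w + w $ i * ?g y $ s $ i)) (at y)"
    using differentiable_randers_tensor[OF assms, of b s]
    by (intro has_derivative_sum has_derivative_mult) (auto simp: frechet_derivative_works)
  have eq: "(\<Sum>i\<in>UNIV. v $ i * ?g v $ s $ i) = randers_norm H b v * randers_diff H b v $ s" if "v \<in> - {0}" for v
  proof -
    have "(\<Sum>i\<in>UNIV. v $ i * ?g v $ s $ i) = (?g v *v v) $ s"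
      by (simp add: matrix_vector_mult_def mult.commute)
    then show ?thesis using that by (simp add: randers_tensor_self[OF assms(1)])
  qed
  have "((\<lambda>v. \<Sum>i\<in>UNIV. v $ i * ?g v $ s $ i) has_derivative (\<lambda>w. (?g y *v w) $ s)) (at y)"
    by (subst has_derivative_cong_open[of "- {0}" y, OF _ _ eq])
       (use assms has_derivative_norm_times_diff[OF assms, of b s] in auto)
  from has_derivative_unique[OF 1 this, THEN fun_cong, of "axis m 1"]
  have "(\<Sum>i\<in>UNIV. y $ i * pd m (\<lambda>v. ?g v $ s $ i) y) + (\<Sum>i\<in>UNIV. axis m 1 $ i * ?g y $ s $ i) = ?g y $ s $ m"
    by (simp add: sum.distrib matrix_vector_axis_nth pd_def)
  moreover have "(\<Sum>i\<in>UNIV. axis m 1 $ i * ?g y $ s $ i) = ?g y $ s $ m"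
    by (simp add: axis_def if_distrib[of "\<lambda>x. x * _"] cong: if_cong)
  ultimately show ?thesis by simp
qed

section \<open>The spray of a Randers metric\<close>

lemma vec_basis_sum: "(\<Sum>j\<in>UNIV. (y::real^'n) $ j *\<^sub>R axis j 1) = y"
  using basis_expansion[of y] by (simp add: scalar_mult_eq_scaleR)

lemma linear_basis_sum:
  assumes "linear f"
  shows "(\<Sum>j\<in>UNIV. y $ j *\<^sub>R f (axis j 1)) = f (y::real^'n)"
  using linear_sum[OF assms, of "\<lambda>j. y $ j *\<^sub>R axis j 1" UNIV]
  by (simp add: vec_basis_sum linear_scale[OF assms])

lemma bounded_linear_matrix_apply: "bounded_linear (\<lambda>A::real^'n^'m. A *v y)"
  by (auto intro!: linearI simp: linear_conv_bounded_linear[symmetric]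
     matrix_vector_mult_add_rdistrib scaleR_matrix_vector_assoc)

lemma has_derivative_apply:
  fixes H :: "'a::real_normed_vector \<Rightarrow> real^'n^'m"
  assumes "(H has_derivative DH) F"
  shows "((\<lambda>x. H x *v y) has_derivative (\<lambda>w. DH w *v y)) F"
  using bounded_linear.has_derivative[OF bounded_linear_matrix_apply assms] .

text \<open>The derivatives of the Randers norm \<open>F\<close> and of its differential \<open>L\<close>, at a fixed velocity \<open>y\<close>,
  when \<open>H\<close> and \<open>b\<close> vary with derivatives \<open>A\<close> and \<open>a\<close>.\<close>

definition dnorm :: "real^'n^'n \<Rightarrow> real^'n^'n \<Rightarrow> real^'n \<Rightarrow> real^'n \<Rightarrow> real" where
  "dnorm H A a y = (y \<bullet> (A *v y)) / (2 * hnorm H y) + a \<bullet> y"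

definition ddiff :: "real^'n^'n \<Rightarrow> real^'n^'n \<Rightarrow> real^'n \<Rightarrow> real^'n \<Rightarrow> real^'n" where
  "ddiff H A a y = (1 / hnorm H y) *\<^sub>R (A *v y) - ((y \<bullet> (A *v y)) / (2 * hnorm H y ^ 3)) *\<^sub>R (H *v y) + a"

lemma hnorm_field_derivative:
  assumes H: "(H has_derivative DH) (at x)" and "pos_sym (H x)" "y \<noteq> 0"
  shows "((\<lambda>x. hnorm (H x) y) has_derivative (\<lambda>w. (y \<bullet> (DH w *v y)) / (2 * hnorm (H x) y))) (at x)"
proof -
  have pos: "y \<bullet> (H x *v y) > 0" using assms by (simp add: pos_sym_def)
  have A: "((\<lambda>x. y \<bullet> (H x *v y)) has_derivative (\<lambda>w. y \<bullet> (DH w *v y))) (at x)"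
    by (intro has_derivative_inner_right has_derivative_apply H)
  have B: "((\<lambda>x. sqrt (y \<bullet> (H x *v y))) has_derivative
      (\<lambda>w. (y \<bullet> (DH w *v y)) * (inverse (sqrt (y \<bullet> (H x *v y))) / 2))) (at x)"
    by (rule has_derivative_real_sqrt[OF _ A]) (fact pos)
  have eq: "a / (2 * s) = a * (inverse s / 2)" for a s :: real
    by (simp add: inverse_eq_divide)
  show ?thesis using B unfolding hnorm_def[abs_def] eq[symmetric] .
qed

lemma randers_norm_field_derivative:
  assumes H: "(H has_derivative DH) (at x)" and b: "(b has_derivative Db) (at x)"
    and "pos_sym (H x)" "y \<noteq> 0"
  shows "((\<lambda>x. randers_norm (H x) (b x) y) has_derivative (\<lambda>w. dnorm (H x) (DH w) (Db w) y)) (at x)"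
  unfolding randers_norm_def dnorm_def
  by (intro has_derivative_add hnorm_field_derivative has_derivative_inner_left assms)

lemma randers_diff_field_derivative:
  assumes H: "(H has_derivative DH) (at x)" and b: "(b has_derivative Db) (at x)"
    and p: "pos_sym (H x)" "y \<noteq> 0"
  shows "((\<lambda>x. randers_diff (H x) (b x) y $ s) has_derivative (\<lambda>w. ddiff (H x) (DH w) (Db w) y $ s)) (at x)"
proof -
  have *: "(\<lambda>x. randers_diff (H x) (b x) y $ s) = (\<lambda>x. (H x *v y) $ s / hnorm (H x) y + b x $ s)"
    by (simp add: fun_eq_iff randers_diff_def)
  have nz: "hnorm (H x) y \<noteq> 0" using hnorm_pos[OF p] by simp
  have "((\<lambda>x. (H x *v y) $ s / hnorm (H x) y + b x $ s) has_derivative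
    (\<lambda>w. ((DH w *v y) $ s * hnorm (H x) y - (H x *v y) $ s * ((y \<bullet> (DH w *v y)) / (2 * hnorm (H x) y)))
           / (hnorm (H x) y * hnorm (H x) y) + Db w $ s)) (at x)"
    by (intro has_derivative_add has_derivative_divide' nz hnorm_field_derivative[OF H p]
       has_derivative_vec_nth has_derivative_apply H b)
  moreover have "((DH w *v y) $ s * hnorm (H x) y - (H x *v y) $ s * ((y \<bullet> (DH w *v y)) / (2 * hnorm (H x) y)))
           / (hnorm (H x) y * hnorm (H x) y) + Db w $ s = ddiff (H x) (DH w) (Db w) y $ s" for w
    using nz by (simp add: ddiff_def power3_eq_cube diff_divide_distrib mult_ac)
  ultimately show ?thesis unfolding * by simp
qed

lemma differentiable_randers_tensor_field:
  assumes H: "(H has_derivative DH) (at x)" and b: "(b has_derivative Db) (at x)"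
    and p: "pos_sym (H x)" "y \<noteq> 0"
  shows "(\<lambda>x. randers_tensor (H x) (b x) y $ s $ i) differentiable (at x)"
proof -
  have *: "(\<lambda>x. randers_tensor (H x) (b x) y $ s $ i) = (\<lambda>x. randers_diff (H x) (b x) y $ s * randers_diff (H x) (b x) y $ i
     + randers_norm (H x) (b x) y / hnorm (H x) y * (H x $ s $ i - (H x *v y) $ s * (H x *v y) $ i / (hnorm (H x) y)\<^sup>2))"
    by (simp add: randers_tensor_def)
  show ?thesis unfolding * using hnorm_pos[OF p]
    by (intro derivative_intros differentiable_divide
       differentiableI[OF randers_diff_field_derivative[OF assms]]
       differentiableI[OF randers_norm_field_derivative[OF assms]]
       differentiableI[OF hnorm_field_derivative[OF H p]]
       differentiableI[OF has_derivative_vec_nth[OF has_derivative_vec_nth[OF H]]]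
       differentiableI[OF has_derivative_vec_nth[OF has_derivative_apply[OF H]]]) auto
qed

lemma ddiff_inner:
  assumes "pos_sym H" "y \<noteq> 0"
  shows "ddiff H A a y \<bullet> y = dnorm H A a y"
proof -
  have 1: "(H *v y) \<bullet> y = hnorm H y * hnorm H y"
    by (simp add: hnorm_square[OF assms(1)] inner_commute flip: power2_eq_square)
  have 2: "(A *v y) \<bullet> y = y \<bullet> (A *v y)" by (rule inner_commute)
  have "t / n - t / (2 * n ^ 3) * (n * n) = t / (2 * n)" if "n > 0" for t n :: real
    using that by (simp add: power3_eq_cube field_simps)
  then show ?thesis using hnorm_pos[OF assms] 
    by (simp add: ddiff_def dnorm_def inner_left_distrib inner_diff_left 1 2)
qed

text \<open>A Randers metric on an open set of coordinates, together with the derivatives \<open>DH\<close> and \<open>Db\<close> of its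
  components at one point \<open>x\<close> and one nonzero velocity \<open>y\<close>.\<close>

locale randers_field =
  fixes H :: "real^'n \<Rightarrow> real^'n^'n" and b :: "real^'n \<Rightarrow> real^'n" and \<Omega>
    and DH :: "real^'n \<Rightarrow> real^'n^'n" and Db :: "real^'n \<Rightarrow> real^'n" and x y :: "real^'n"
  assumes open_dom: "open \<Omega>" and x: "x \<in> \<Omega>" and ps: "\<And>z. z \<in> \<Omega> \<Longrightarrow> pos_sym (H z)"
    and H: "(H has_derivative DH) (at x)" and b: "(b has_derivative Db) (at x)"
    and y: "y \<noteq> 0"
begin

text \<open>The Randers metric as a function of position and velocity.\<close>

definition "F \<equiv> \<lambda>x. randers_norm (H x) (b x)"

abbreviation "g \<equiv> \<lambda>x y. randers_tensor (H x) (b x) y"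

abbreviation "dF w \<equiv> dnorm (H x) (DH w) (Db w) y"
abbreviation "dL w \<equiv> ddiff (H x) (DH w) (Db w) y"
abbreviation "L \<equiv> randers_diff (H x) (b x) y"

lemma psx: "pos_sym (H x)" using ps x by blast

text \<open>The derivative of \<open>F L\<^sub>s\<close> with respect to the \<open>k\<close>-th coordinate.\<close>

definition P :: "'n \<Rightarrow> 'n \<Rightarrow> real" where
  "P k s = F x y * dL (axis k 1) $ s + dF (axis k 1) * L $ s"

lemma fund: "z \<in> \<Omega> \<Longrightarrow> v \<noteq> 0 \<Longrightarrow> fund_tensor F z v = g z v"
  unfolding F_def using ps by (rule fund_tensor_randers)

lemma pd_fund_x: "pd k (\<lambda>z. fund_tensor F z y $ i $ j) x = pd k (\<lambda>z. g z y $ i $ j) x"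
  by (rule pd_cong_open[OF open_dom x]) (simp add: fund y)

lemma pd_fund_y: "pd k (\<lambda>v. fund_tensor F x v $ i $ j) y = pd k (\<lambda>v. g x v $ i $ j) y"
  by (rule pd_cong_open[of "- {0}"]) (use y x in \<open>auto simp: fund\<close>)

lemma horizontal: "horizontal_pd F k i j x y = pd k (\<lambda>z. g z y $ i $ j) x
     - (\<Sum>m\<in>UNIV. nonlinear_connection F m k x y * pd m (\<lambda>v. g x v $ i $ j) y)"
  unfolding horizontal_pd_def pd_fund_x pd_fund_y ..

lemma pd_tensor_field: "(\<Sum>i\<in>UNIV. y $ i * pd k (\<lambda>z. g z y $ s $ i) x) = P k s"
proof -
  have 1: "((\<lambda>z. \<Sum>i\<in>UNIV. y $ i * g z y $ s $ i) has_derivative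
      (\<lambda>w. \<Sum>i\<in>UNIV. y $ i * frechet_derivative (\<lambda>z. g z y $ s $ i) (at x) w)) (at x)"
    using differentiable_randers_tensor_field[OF H b psx y, of s]
    by (intro has_derivative_sum has_derivative_mult_right) (auto simp: frechet_derivative_works)
  have eq: "(\<Sum>i\<in>UNIV. y $ i * g z y $ s $ i) = randers_norm (H z) (b z) y * randers_diff (H z) (b z) y $ s"
    if "z \<in> \<Omega>" for z
  proof -
    have "(\<Sum>i\<in>UNIV. y $ i * g z y $ s $ i) = (g z y *v y) $ s"
      by (simp add: matrix_vector_mult_def mult.commute)
    then show ?thesis by (simp add: randers_tensor_self[OF ps[OF that] y])
  qed
  have 2: "((\<lambda>z. randers_norm (H z) (b z) y * randers_diff (H z) (b z) y $ s) has_derivative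
     (\<lambda>w. randers_norm (H x) (b x) y * dL w $ s + dF w * L $ s)) (at x)"
    by (intro has_derivative_mult randers_norm_field_derivative randers_diff_field_derivative H b psx y)
  have "((\<lambda>z. \<Sum>i\<in>UNIV. y $ i * g z y $ s $ i) has_derivative
     (\<lambda>w. randers_norm (H x) (b x) y * dL w $ s + dF w * L $ s)) (at x)"
    by (subst has_derivative_cong_open[OF open_dom x eq]) (assumption | rule 2)+
  from has_derivative_unique[OF 1 this, THEN fun_cong, of "axis k 1"]
  show ?thesis unfolding P_def pd_def F_def .
qed

text \<open>Horizontal derivatives of \<open>g\<close> contracted with \<open>y\<close> do not see the nonlinear connection,
  because it enters only through the Cartan tensor.\<close>

lemma horizontal_contract: "(\<Sum>i\<in>UNIV. y $ i * horizontal_pd F k s i x y) = P k s"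
proof -
  have "(\<Sum>i\<in>UNIV. y $ i * horizontal_pd F k s i x y) = (\<Sum>i\<in>UNIV. y $ i * pd k (\<lambda>z. g z y $ s $ i) x)
     - (\<Sum>m\<in>UNIV. nonlinear_connection F m k x y * (\<Sum>i\<in>UNIV. y $ i * pd m (\<lambda>v. g x v $ s $ i) y))"
  proof -
    have "(\<Sum>i\<in>UNIV. y $ i * (\<Sum>m\<in>UNIV. nonlinear_connection F m k x y * pd m (\<lambda>v. g x v $ s $ i) y))
      = (\<Sum>m\<in>UNIV. nonlinear_connection F m k x y * (\<Sum>i\<in>UNIV. y $ i * pd m (\<lambda>v. g x v $ s $ i) y))"
      unfolding sum_distrib_left by (subst sum.swap) (simp add: mult.left_commute)
    then show ?thesis
      unfolding horizontal by (simp only: right_diff_distrib sum_subtractf)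
  qed
  then show ?thesis
    by (simp add: pd_tensor_field cartan_homogeneous[OF psx y])
qed

text \<open>The spray of the metric with its index lowered by \<open>g\<close>:
  \<open>V\<^sub>s = y\<^sup>j \<partial>\<^sub>j(F L\<^sub>s) - 1/2 \<partial>\<^sub>s F\<^sup>2\<close>, here in simplified form.\<close>

definition V :: "real^'n" where
  "V = dF y *\<^sub>R L + F x y *\<^sub>R (dL y - (\<chi> s. dF (axis s 1)))"

lemma V_nth: "V $ s = (\<Sum>j\<in>UNIV. y $ j * P j s) - 1/2 * (\<Sum>i\<in>UNIV. y $ i * P s i)"
proof -
  have lF: "linear (\<lambda>w. dF w)"
    by (rule has_derivative_linear[OF randers_norm_field_derivative[OF H b psx y]])
  have lL: "linear (\<lambda>w. dL w $ s)"
    by (rule has_derivative_linear[OF randers_diff_field_derivative[OF H b psx y]])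
  have "(\<Sum>j\<in>UNIV. y $ j * P j s)
      = F x y * (\<Sum>j\<in>UNIV. y $ j *\<^sub>R dL (axis j 1) $ s) + (\<Sum>j\<in>UNIV. y $ j *\<^sub>R dF (axis j 1)) * L $ s"
    by (simp add: P_def sum.distrib sum_distrib_left sum_distrib_right distrib_left mult_ac)
  also have "\<dots> = F x y * dL y $ s + dF y * L $ s"
    unfolding linear_basis_sum[OF lF] linear_basis_sum[OF lL] ..
  finally have 1: "(\<Sum>j\<in>UNIV. y $ j * P j s) = F x y * dL y $ s + dF y * L $ s" .
  have "(\<Sum>i\<in>UNIV. y $ i * P s i) = F x y * (dL (axis s 1) \<bullet> y) + dF (axis s 1) * (L \<bullet> y)"
    by (simp add: P_def sum.distrib sum_distrib_left distrib_left mult_ac inner_vec_def)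
  also have "\<dots> = 2 * F x y * dF (axis s 1)"
    by (simp add: ddiff_inner[OF psx y] randers_diff_self[OF psx y] F_def)
  finally have 2: "(\<Sum>i\<in>UNIV. y $ i * P s i) = 2 * F x y * dF (axis s 1)" .
  show ?thesis unfolding 1 2 by (simp add: V_def right_diff_distrib)
qed

text \<open>Contracted twice with \<open>y\<close>, the Chern connection is the spray.\<close>

lemma chern_contract:
  "(\<Sum>i\<in>UNIV. \<Sum>j\<in>UNIV. y $ i * y $ j * chern F k i j x y) = (matrix_inv (g x y) *v V) $ k"
proof -
  let ?h = "\<lambda>k i j. horizontal_pd F k i j x y"
  let ?G = "\<lambda>s. fund_inv F x y $ k $ s"
  have a: "(\<Sum>i\<in>UNIV. \<Sum>j\<in>UNIV. y $ i * y $ j * ?h j s i) = (\<Sum>j\<in>UNIV. y $ j * P j s)" for s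
    by (subst sum.swap) (simp only: horizontal_contract[symmetric] sum_distrib_left mult_ac)
  have b: "(\<Sum>i\<in>UNIV. \<Sum>j\<in>UNIV. y $ i * y $ j * ?h i s j) = (\<Sum>j\<in>UNIV. y $ j * P j s)" for s
    by (simp only: horizontal_contract[symmetric] sum_distrib_left mult_ac)
  have c: "(\<Sum>i\<in>UNIV. \<Sum>j\<in>UNIV. y $ i * y $ j * ?h s i j) = (\<Sum>i\<in>UNIV. y $ i * P s i)" for s
    by (simp only: horizontal_contract[symmetric] sum_distrib_left mult_ac)
  have "(\<Sum>i\<in>UNIV. \<Sum>j\<in>UNIV. y $ i * y $ j * chern F k i j x y)
    = (\<Sum>i\<in>UNIV. \<Sum>j\<in>UNIV. \<Sum>s\<in>UNIV. ?G s * (1/2 * (y $ i * y $ j * ?h j s i + y $ i * y $ j * ?h i s j - y $ i * y $ j * ?h s i j)))"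
    unfolding chern_def sum_distrib_left by (intro sum.cong refl) (simp add: algebra_simps)
  also have "\<dots> = (\<Sum>s\<in>UNIV. \<Sum>i\<in>UNIV. \<Sum>j\<in>UNIV. ?G s * (1/2 * (y $ i * y $ j * ?h j s i + y $ i * y $ j * ?h i s j - y $ i * y $ j * ?h s i j)))"
    by (rule trans[OF sum.cong[OF refl sum.swap] sum.swap])
  also have "\<dots> = (\<Sum>s\<in>UNIV. ?G s * (1/2 * ((\<Sum>i\<in>UNIV. \<Sum>j\<in>UNIV. y $ i * y $ j * ?h j s i)
      + (\<Sum>i\<in>UNIV. \<Sum>j\<in>UNIV. y $ i * y $ j * ?h i s j) - (\<Sum>i\<in>UNIV. \<Sum>j\<in>UNIV. y $ i * y $ j * ?h s i j))))"
    by (simp only: sum_distrib_left[symmetric] sum.distrib sum_subtractf)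
  also have "\<dots> = (\<Sum>s\<in>UNIV. ?G s * V $ s)"
    unfolding a b c V_nth by (simp add: field_simps)
  finally show ?thesis
    by (simp add: fund_inv_def fund[OF x y] matrix_vector_mult_def)
qed

text \<open>The Christoffel symbols of the first kind of \<open>H\<close> contracted twice with \<open>y\<close>, and the exterior
  derivative of \<open>b\<close> contracted with \<open>y\<close>.\<close>

definition A :: "real^'n" where
  "A = (\<chi> s. (DH y *v y) $ s - 1/2 * (y \<bullet> (DH (axis s 1) *v y)))"

definition B :: "real^'n" where
  "B = (\<chi> s. Db y $ s - Db (axis s 1) \<bullet> y)"

lemma inner_A: "y \<bullet> A = 1/2 * (y \<bullet> (DH y *v y))"
proof -
  have "linear (\<lambda>w. y \<bullet> (DH w *v y))"
    by (rule has_derivative_linear[OF has_derivative_inner_right[OF has_derivative_apply[OF H]]])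
  from linear_basis_sum[OF this, of y]
  have "(\<Sum>s\<in>UNIV. y $ s * (y \<bullet> (DH (axis s 1) *v y))) = y \<bullet> (DH y *v y)" by simp
  moreover have "y \<bullet> A = y \<bullet> (DH y *v y) - 1/2 * (\<Sum>s\<in>UNIV. y $ s * (y \<bullet> (DH (axis s 1) *v y)))"
  proof -
    have "y \<bullet> A = (\<Sum>s\<in>UNIV. y $ s * A $ s)" by (simp add: inner_vec_def)
    also have "\<dots> = (\<Sum>s\<in>UNIV. y $ s * (DH y *v y) $ s) - 1/2 * (\<Sum>s\<in>UNIV. y $ s * (y \<bullet> (DH (axis s 1) *v y)))"
      by (simp add: A_def right_diff_distrib sum_subtractf sum_distrib_left)
    finally show ?thesis by (simp add: inner_vec_def[of y "DH y *v y"])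
  qed
  ultimately show ?thesis by simp
qed

lemma inner_B: "y \<bullet> B = 0"
proof -
  have "linear (\<lambda>w. Db w \<bullet> y)"
    by (rule has_derivative_linear[OF has_derivative_inner_left[OF b]])
  from linear_basis_sum[OF this, of y]
  have "(\<Sum>s\<in>UNIV. y $ s * (Db (axis s 1) \<bullet> y)) = Db y \<bullet> y" by simp
  moreover have "y \<bullet> B = y \<bullet> Db y - (\<Sum>s\<in>UNIV. y $ s * (Db (axis s 1) \<bullet> y))"
  proof -
    have "y \<bullet> B = (\<Sum>s\<in>UNIV. y $ s * B $ s)" by (simp add: inner_vec_def)
    also have "\<dots> = (\<Sum>s\<in>UNIV. y $ s * Db y $ s) - (\<Sum>s\<in>UNIV. y $ s * (Db (axis s 1) \<bullet> y))"
      by (simp add: B_def right_diff_distrib sum_subtractf)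
    finally show ?thesis by (simp add: inner_vec_def[of y "Db y"])
  qed
  ultimately show ?thesis by (simp add: inner_commute)
qed

text \<open>The geodesic equation of a Randers metric, up to a multiple of \<open>y\<close>: the Levi-Civita spray of \<open>H\<close>
  is perturbed by the Lorentz force of \<open>b\<close> alone. All remaining terms of \<open>V\<close> are multiples of
  \<open>L = g y / F\<close>, hence contribute multiples of \<open>y\<close> after raising the index.\<close>

lemma spray:
  assumes u: "H x *v u = A + hnorm (H x) y *\<^sub>R B" and F0: "F x y \<noteq> 0"
  obtains c where "\<And>k. (\<Sum>i\<in>UNIV. \<Sum>j\<in>UNIV. y $ i * y $ j * chern F k i j x y) = (u + c *\<^sub>R y) $ k"
proof
  define \<alpha> where "\<alpha> = hnorm (H x) y"
  have \<alpha>: "\<alpha> > 0" unfolding \<alpha>_def by (rule hnorm_pos[OF psx y])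
  let ?a = "y \<bullet> (DH y *v y)"
  define c where "c = (dF y - L \<bullet> u) / F x y"
  have yu: "(H x *v y) \<bullet> u = 1/2 * ?a"
    unfolding pos_sym_inner[OF psx, symmetric] u by (simp add: inner_right_distrib inner_A inner_B)
  have "V = g x y *v (u + c *\<^sub>R y)"
    unfolding vec_eq_iff
  proof
    fix s
    have "(g x y *v (u + c *\<^sub>R y)) $ s = (g x y *v u) $ s + c * (F x y * L $ s)"
      by (simp add: matrix_vector_right_distrib matrix_vector_mult_scaleR randers_tensor_self[OF psx y] F_def)
    also have "c * (F x y * L $ s) = (dF y - L \<bullet> u) * L $ s"
      using F0 by (simp add: c_def)
    also have "(g x y *v u) $ s = (L \<bullet> u) * L $ s + F x y / \<alpha> * ((A $ s + \<alpha> * B $ s) - (1/2 * ?a) / \<alpha>\<^sup>2 * (H x *v y) $ s)"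
      unfolding randers_tensor_apply yu u by (simp add: F_def \<alpha>_def)
    also have "F x y / \<alpha> * ((A $ s + \<alpha> * B $ s) - (1/2 * ?a) / \<alpha>\<^sup>2 * (H x *v y) $ s)
       = F x y * (dL y $ s - dF (axis s 1))"
      using \<alpha> unfolding A_def B_def ddiff_def dnorm_def \<alpha>_def[symmetric]
      by (simp add: field_simps power2_eq_square power3_eq_cube)
    finally show "V $ s = (g x y *v (u + c *\<^sub>R y)) $ s"
      unfolding V_def by (simp add: left_diff_distrib)
  qed
  then show "\<And>k. (\<Sum>i\<in>UNIV. \<Sum>j\<in>UNIV. y $ i * y $ j * chern F k i j x y) = (u + c *\<^sub>R y) $ k"
    by (simp add: chern_contract randers_tensor_inv[OF psx y F0[unfolded F_def]])
qed

end

section \<open>Coordinate spheres in almost flat coordinates\<close>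

lemma matrix_entry_bound:
  fixes M :: "real^'n^'m"
  assumes "\<And>i j. \<bar>M $ i $ j\<bar> \<le> e"
  shows "norm (M *v w) \<le> real CARD('m) * real CARD('n) * e * norm w"
proof -
  have "\<bar>(M *v w) $ i\<bar> \<le> real CARD('n) * (e * norm w)" for i
  proof -
    have "\<bar>M $ i $ j * w $ j\<bar> \<le> e * norm w" for j
      using mult_mono[OF assms[of i j] component_le_norm_cart[of w j]] assms[of i j]
      by (simp add: abs_mult)
    then have "\<bar>\<Sum>j\<in>UNIV. M $ i $ j * w $ j\<bar> \<le> (\<Sum>j\<in>(UNIV::'n set). e * norm w)"
      by (intro sum_abs[THEN order_trans] sum_mono)
    then show ?thesis by (simp add: matrix_vector_mult_def)
  qed
  then have "(\<Sum>i\<in>UNIV. \<bar>(M *v w) $ i\<bar>) \<le> (\<Sum>i\<in>(UNIV::'m set). real CARD('n) * (e * norm w))"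
    by (intro sum_mono)
  with norm_le_l1_cart[of "M *v w"] show ?thesis by (simp add: mult_ac)
qed

lemma norm_le_card_bound:
  fixes v :: "real^'n"
  assumes "\<And>i. \<bar>v $ i\<bar> \<le> e"
  shows "norm v \<le> real CARD('n) * e"
proof -
  have "(\<Sum>i\<in>UNIV. \<bar>v $ i\<bar>) \<le> (\<Sum>i\<in>(UNIV::'n set). e)"
    by (intro sum_mono assms)
  with norm_le_l1_cart[of v] show ?thesis by simp
qed

lemma quadratic_form_near_identity:
  fixes H :: "real^'n^'n"
  assumes "\<And>i j. \<bar>H $ i $ j - (if i = j then 1 else 0)\<bar> \<le> e" "real CARD('n) * real CARD('n) * e \<le> 1/2"
  shows "1/2 * (v \<bullet> v) \<le> v \<bullet> (H *v v)" "v \<bullet> (H *v v) \<le> 2 * (v \<bullet> v)"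
proof -
  have "\<bar>(H - mat 1) $ i $ j\<bar> \<le> e" for i j using assms(1)[of i j] by (simp add: mat_def)
  from matrix_entry_bound[OF this] have "norm ((H - mat 1) *v v) \<le> real CARD('n) * real CARD('n) * e * norm v" .
  also have "\<dots> \<le> 1/2 * norm v" by (intro mult_right_mono assms(2)) simp
  finally have "norm v * norm ((H - mat 1) *v v) \<le> norm v * (1/2 * norm v)"
    by (intro mult_left_mono) auto
  then have "\<bar>v \<bullet> ((H - mat 1) *v v)\<bar> \<le> 1/2 * (v \<bullet> v)"
    using Cauchy_Schwarz_ineq2[of v "(H - mat 1) *v v"] by (simp add: dot_square_norm power2_eq_square)
  moreover have "v \<bullet> ((H - mat 1) *v v) = v \<bullet> (H *v v) - v \<bullet> v"
    by (simp add: matrix_vector_mult_diff_rdistrib inner_diff_right)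
  ultimately show "1/2 * (v \<bullet> v) \<le> v \<bullet> (H *v v)" "v \<bullet> (H *v v) \<le> 2 * (v \<bullet> v)"
    using inner_ge_zero[of v] by linarith+
qed

lemma hnorm_near_identity:
  assumes "1/2 * (v \<bullet> v) \<le> v \<bullet> (H *v v)" "v \<bullet> (H *v v) \<le> 2 * (v \<bullet> v)"
  shows "1/2 * norm v \<le> hnorm H v" "hnorm H v \<le> 2 * norm v"
proof -
  have "(1/2 * norm v)\<^sup>2 = 1/4 * (v \<bullet> v)"
    by (simp add: power_divide dot_square_norm)
  then have "(1/2 * norm v)\<^sup>2 \<le> v \<bullet> (H *v v)"
    using assms(1) inner_ge_zero[of v] by linarith
  then show "1/2 * norm v \<le> hnorm H v" unfolding hnorm_def by (rule real_le_rsqrt)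
  have "(2 * norm v)\<^sup>2 = 4 * (v \<bullet> v)"
    by (simp add: power_mult_distrib dot_square_norm)
  then have "v \<bullet> (H *v v) \<le> (2 * norm v)\<^sup>2"
    using assms(2) inner_ge_zero[of v] by linarith
  then show "hnorm H v \<le> 2 * norm v" unfolding hnorm_def by (intro real_le_lsqrt) simp_all
qed

lemma pos_sym_solvable:
  assumes "pos_sym H"
  obtains u where "H *v u = w"
proof -
  have "H *v v = 0 \<Longrightarrow> v = 0" for v
    using assms unfolding pos_sym_def by force
  then have "invertible H"
    by (auto simp: invertible_left_inverse matrix_left_invertible_ker)
  then obtain G where "H ** G = mat 1" unfolding invertible_def by blast
  then have "H *v (G *v w) = w" by (simp add: matrix_vector_mul_assoc)
  then show ?thesis by (rule that)
qed

text \<open>The norm \<open>covector_norm\<close> is a supremum of reals, so that the lower bound on \<open>hnorm\<close> is needed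
  to know that the supremum dominates its terms.\<close>

lemma randers_norm_pos:
  assumes "covector_norm H b < 1" and "pos_sym H" and "c > 0" "\<And>v. c * norm v \<le> hnorm H v" and y: "y \<noteq> 0"
  shows "randers_norm H b y > 0"
proof -
  have "\<bar>b \<bullet> v\<bar> / hnorm H v \<le> norm b / c" if "v \<noteq> 0" for v
  proof -
    have "\<bar>b \<bullet> v\<bar> / hnorm H v \<le> (norm b * norm v) / (c * norm v)"
      using that assms(3) by (intro frac_le Cauchy_Schwarz_ineq2 assms(4)) auto
    then show ?thesis using that by simp
  qed
  then have "bdd_above ((\<lambda>v. \<bar>b \<bullet> v\<bar> / hnorm H v) ` (UNIV - {0}))"
    by (intro bdd_aboveI2) auto
  then have "\<bar>b \<bullet> y\<bar> / hnorm H y \<le> covector_norm H b"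
    unfolding covector_norm_def hnorm_def[symmetric] by (rule cSUP_upper2[OF _ _ order_refl]) (use y in auto)
  then have "\<bar>b \<bullet> y\<bar> / hnorm H y < 1" using assms(1) by simp
  then show ?thesis using hnorm_pos[OF assms(2) y] by (simp add: randers_norm_def)
qed

lemma has_derivative_square_norm:
  "((\<lambda>z. c - z \<bullet> z) has_derivative (\<lambda>w. - 2 * (z \<bullet> w))) (at (z::real^'n))"
proof -
  have "((\<lambda>z. c - z \<bullet> z) has_derivative (\<lambda>w. 0 - (z \<bullet> w + w \<bullet> z))) (at z)"
    by (intro has_derivative_diff has_derivative_const has_derivative_inner has_derivative_ident)
  then show ?thesis by (simp add: inner_commute)
qed

lemma pd_square_norm: "pd j (\<lambda>z. c - z \<bullet> z) z = - 2 * (z $ j)"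
  using pd_eq_has_derivative[OF has_derivative_square_norm] by (simp add: inner_axis)

context randers_field begin

text \<open>For \<open>f = c - |x|\<^sup>2\<close> and \<open>y\<close> tangent to the sphere through \<open>x\<close>, the component of the spray along \<open>y\<close> is
  killed by \<open>df\<close>.\<close>

lemma hessian_square_norm:
  assumes N: "open N" "x \<in> N" and f: "\<And>z. z \<in> N \<Longrightarrow> f z = c - z \<bullet> z"
    and xy: "x \<bullet> y = 0" and u: "H x *v u = A + hnorm (H x) y *\<^sub>R B" and F0: "F x y \<noteq> 0"
  shows "chern_hessian F f x y y y = - 2 * (y \<bullet> y) + 2 * (x \<bullet> u)"
proof -
  obtain d where d: "\<And>k. (\<Sum>i\<in>UNIV. \<Sum>j\<in>UNIV. y $ i * y $ j * chern F k i j x y) = (u + d *\<^sub>R y) $ k"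
    using spray[OF u F0] by blast
  have p1: "pd j f z = - 2 * (z $ j)" if "z \<in> N" for j z
    using pd_cong_open[OF N(1) that f, where i = j] by (simp add: pd_square_norm)
  have p2: "pd i (pd j f) x = (if i = j then - 2 else 0)" for i j
  proof -
    have "((\<lambda>z. - 2 * (z $ j)) has_derivative (\<lambda>w. - 2 * (w $ j))) (at x)"
      by (intro has_derivative_mult_right has_derivative_vec_nth has_derivative_ident)
    from pd_eq_has_derivative[OF this, where i = i] have "pd i (\<lambda>z. - 2 * (z $ j)) x = (if i = j then - 2 else 0)"
      by (simp add: axis_def)
    moreover have "pd i (pd j f) x = pd i (\<lambda>z. - 2 * (z $ j)) x"
      by (rule pd_cong_open[OF N]) (rule p1)
    ultimately show ?thesis by simp
  qed
  have "chern_hessian F f x y y y = (\<Sum>i\<in>UNIV. \<Sum>j\<in>UNIV. y $ i * y $ j * (if i = j then - 2 else 0))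
      + 2 * (\<Sum>i\<in>UNIV. \<Sum>j\<in>UNIV. \<Sum>k\<in>UNIV. x $ k * (y $ i * y $ j * chern F k i j x y))"
    unfolding chern_hessian_def p2 p1[OF N(2)]
    by (simp add: right_diff_distrib distrib_left sum.distrib sum_subtractf sum_distrib_left sum_negf mult_ac)
  also have "(\<Sum>i\<in>UNIV. \<Sum>j\<in>UNIV. y $ i * y $ j * (if i = j then - 2 else 0)) = - 2 * (y \<bullet> y)"
  proof -
    have "(\<Sum>j\<in>UNIV. y $ i * y $ j * (if i = j then - 2 else 0)) = - 2 * (y $ i * y $ i)" for i
      by (simp add: if_distrib[of "\<lambda>t. _ * t"] cong: if_cong)
    then show ?thesis by (simp only: inner_vec_def inner_real_def sum_distrib_left)
  qed
  also have "(\<Sum>i\<in>UNIV. \<Sum>j\<in>UNIV. \<Sum>k\<in>UNIV. x $ k * (y $ i * y $ j * chern F k i j x y))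
     = (\<Sum>k\<in>UNIV. x $ k * (\<Sum>i\<in>UNIV. \<Sum>j\<in>UNIV. y $ i * y $ j * chern F k i j x y))"
    unfolding sum_distrib_left by (rule trans[OF sum.cong[OF refl sum.swap] sum.swap])
  also have "\<dots> = x \<bullet> (u + d *\<^sub>R y)"
    unfolding d by (simp add: inner_vec_def)
  finally show ?thesis by (simp add: inner_right_distrib xy)
qed

text \<open>The correction term \<open>2 x \<bullet> u\<close> of the Hessian is at most \<open>16 n\<^sup>3 e |y|\<^sup>2\<close> for \<open>n\<close> the dimension, which
  by the choice of \<open>e\<close> is half of the leading term \<open>2 |y|\<^sup>2\<close>.\<close>

lemma hessian_neg:
  assumes N: "open N" "x \<in> N" and f: "\<And>z. z \<in> N \<Longrightarrow> f z = c - z \<bullet> z"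
    and xy: "x \<bullet> y = 0" and x0: "x \<noteq> 0"
    and cov: "covector_norm (H x) (b x) < 1"
    and e: "e = 1 / (16 * real CARD('n) ^ 3)"
    and h0: "\<And>i j. \<bar>H x $ i $ j - (if i = j then 1 else 0)\<bar> \<le> e"
    and h1: "\<And>i j k. \<bar>DH (axis k 1) $ i $ j\<bar> \<le> e / norm x"
    and w1: "\<And>i j. \<bar>Db (axis i 1) $ j - Db (axis j 1) $ i\<bar> \<le> e / norm x"
  shows "chern_hessian F f x y y y < 0"
proof -
  let ?N = "real CARD('n)"
  define d where "d = e / norm x"
  have N1: "?N \<ge> 1" by (simp add: Suc_leI)
  have epos: "e > 0" using N1 by (simp add: e)
  have dpos: "d > 0" using epos x0 by (simp add: d_def)
  have N23: "?N * ?N \<le> ?N ^ 3"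
    using mult_left_mono[OF N1, of "?N * ?N"] by (simp add: power3_eq_cube)
  have eN: "?N ^ 3 * e = 1/16" using N1 by (simp add: e)
  have "?N * ?N * e \<le> ?N ^ 3 * e" using epos by (intro mult_right_mono N23) simp
  then have e2: "?N * ?N * e \<le> 1/2" using eN by linarith
  note q = quadratic_form_near_identity[OF h0 e2]
  note hn = hnorm_near_identity[OF q]
  obtain u where u: "H x *v u = A + hnorm (H x) y *\<^sub>R B" using pos_sym_solvable[OF psx] by blast
  have "F x y > 0" unfolding F_def
    by (rule randers_norm_pos[OF cov psx _ _ y, of "1/2"]) (use hn(1) in auto)
  then have hess: "chern_hessian F f x y y y = - 2 * (y \<bullet> y) + 2 * (x \<bullet> u)"
    by (intro hessian_square_norm[OF N f xy u]) auto
  have lin: "linear DH" "linear Db" using H b by (auto dest: has_derivative_linear)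
  have bA: "norm A \<le> 2 * (?N ^ 3 * d * (norm y * norm y))"
  proof -
    have "\<bar>DH y $ i $ j\<bar> \<le> ?N * (d * norm y)" for i j
    proof -
      have "DH y $ i $ j = (\<Sum>k\<in>UNIV. y $ k * DH (axis k 1) $ i $ j)"
        using arg_cong[OF linear_basis_sum[OF lin(1), of y], of "\<lambda>M. M $ i $ j"] by simp
      moreover have "\<bar>y $ k * DH (axis k 1) $ i $ j\<bar> \<le> d * norm y" for k
        using mult_mono[OF h1[of k i j] component_le_norm_cart[of y k]] epos
        by (simp add: abs_mult d_def mult_ac)
      then have "\<bar>\<Sum>k\<in>UNIV. y $ k * DH (axis k 1) $ i $ j\<bar> \<le> (\<Sum>k\<in>(UNIV::'n set). d * norm y)"
        by (intro sum_abs[THEN order_trans] sum_mono)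
      ultimately show ?thesis by simp
    qed
    from matrix_entry_bound[OF this, of y]
    have 1: "norm (DH y *v y) \<le> ?N ^ 3 * d * (norm y * norm y)"
      by (simp add: power3_eq_cube mult_ac)
    have "\<bar>(\<chi> s. 1/2 * (y \<bullet> (DH (axis s 1) *v y))) $ s\<bar> \<le> ?N * ?N * d * (norm y * norm y)" for s
    proof -
      have "\<bar>y \<bullet> (DH (axis s 1) *v y)\<bar> \<le> norm y * norm (DH (axis s 1) *v y)"
        by (rule Cauchy_Schwarz_ineq2)
      also have "\<dots> \<le> norm y * (?N * ?N * d * norm y)"
        using matrix_entry_bound[OF h1, of s y] by (intro mult_left_mono) (simp_all add: d_def)
      finally show ?thesis by (simp add: mult_ac)
    qed
    from norm_le_card_bound[OF this]
    have 2: "norm (\<chi> s. 1/2 * (y \<bullet> (DH (axis s 1) *v y))) \<le> ?N ^ 3 * d * (norm y * norm y)"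
      by (simp add: power3_eq_cube mult_ac)
    have "A = DH y *v y - (\<chi> s. 1/2 * (y \<bullet> (DH (axis s 1) *v y)))"
      by (simp add: A_def vec_eq_iff)
    then show ?thesis using norm_triangle_ineq4[of "DH y *v y" "\<chi> s. 1/2 * (y \<bullet> (DH (axis s 1) *v y))"] 1 2
      by simp
  qed
  have bB: "norm B \<le> ?N ^ 3 * d * norm y"
  proof -
    have "\<bar>B $ s\<bar> \<le> ?N * (d * norm y)" for s
    proof -
      have "Db y $ s = (\<Sum>k\<in>UNIV. y $ k * Db (axis k 1) $ s)"
        using arg_cong[OF linear_basis_sum[OF lin(2), of y], of "\<lambda>M. M $ s"] by simp
      then have "B $ s = (\<Sum>k\<in>UNIV. y $ k * (Db (axis k 1) $ s - Db (axis s 1) $ k))"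
        by (simp add: B_def inner_vec_def right_diff_distrib sum_subtractf mult_ac)
      moreover have "\<bar>y $ k * (Db (axis k 1) $ s - Db (axis s 1) $ k)\<bar> \<le> d * norm y" for k
        using mult_mono[OF w1[of k s] component_le_norm_cart[of y k]] epos
        by (simp add: abs_mult d_def mult_ac)
      then have "\<bar>\<Sum>k\<in>UNIV. y $ k * (Db (axis k 1) $ s - Db (axis s 1) $ k)\<bar> \<le> (\<Sum>k\<in>(UNIV::'n set). d * norm y)"
        by (intro sum_abs[THEN order_trans] sum_mono)
      ultimately show ?thesis by simp
    qed
    from norm_le_card_bound[OF this] have "norm B \<le> (?N * ?N) * (d * norm y)" by (simp add: mult_ac)
    also have "\<dots> \<le> ?N ^ 3 * (d * norm y)" using dpos by (intro mult_right_mono N23) simp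
    finally show ?thesis by (simp add: mult_ac)
  qed
  have "norm (H x *v u) \<le> norm A + hnorm (H x) y * norm B"
    using norm_triangle_ineq[of A "hnorm (H x) y *\<^sub>R B"] hnorm_pos[OF psx y] by (simp add: u)
  also have "hnorm (H x) y * norm B \<le> (2 * norm y) * (?N ^ 3 * d * norm y)"
    by (intro mult_mono hn(2) bB) auto
  finally have bu: "norm (H x *v u) \<le> 4 * (?N ^ 3 * d * (norm y * norm y))"
    using bA by (simp add: mult_ac)
  have "1/2 * (norm u * norm u) \<le> norm u * norm (H x *v u)"
    using q(1)[of u] Cauchy_Schwarz_ineq2[of u "H x *v u"] by (simp add: dot_square_norm power2_eq_square)
  then have "norm u \<le> 2 * norm (H x *v u)"
    by (cases "u = 0") (auto simp: mult.left_commute[of "1/2"])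
  then have "norm u \<le> 8 * (?N ^ 3 * d * (norm y * norm y))" using bu by linarith
  then have "norm x * norm u \<le> norm x * (8 * (?N ^ 3 * d * (norm y * norm y)))"
    by (intro mult_left_mono) auto
  also have "\<dots> = 8 * ((?N ^ 3 * e) * (norm y * norm y))"
    using x0 by (simp add: d_def)
  also have "\<dots> = 1/2 * (y \<bullet> y)" unfolding eN by (simp add: dot_square_norm power2_eq_square)
  finally have "x \<bullet> u \<le> 1/2 * (y \<bullet> y)"
    using norm_cauchy_schwarz[of x u] by linarith
  moreover have "y \<bullet> y > 0" using y by simp
  ultimately show ?thesis unfolding hess by linarith
qed

end

section \<open>Smooth functions, charts and atlases\<close>

lemma smooth_on_continuous: "smooth_on f S \<Longrightarrow> continuous_on S f"
  unfolding smooth_on_def by (metis Ck_on.simps(1))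

lemma smooth_on_differentiable: "smooth_on f S \<Longrightarrow> x \<in> S \<Longrightarrow> f differentiable (at x)"
  unfolding smooth_on_def by (metis Ck_on.simps(2))

section \<open>The far part of an end is closed\<close>

lemma continuous_endpoint_in_closed:
  fixes a b :: real
  assumes "a < b" "continuous_on {a..b} c" "closed P" "\<And>s. a \<le> s \<Longrightarrow> s < b \<Longrightarrow> c s \<in> P"
  shows "c b \<in> P"
proof -
  have "closed ({a..b} \<inter> c -` P)"
    by (rule continuous_closed_preimage) (use assms in auto)
  moreover have "{a..<b} \<subseteq> {a..b} \<inter> c -` P" using assms by auto
  ultimately have "closure {a..<b} \<subseteq> {a..b} \<inter> c -` P" by (rule closure_minimal[rotated])
  moreover have "b \<in> closure {a..<b}" using assms(1) by simp
  ultimately show ?thesis by blast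
qed

lemma atlas_chart: "smooth_structure \<A> \<Longrightarrow> C \<in> \<A> \<Longrightarrow> is_chart C"
  unfolding smooth_structure_def by blast

lemma atlas_compatible: "smooth_structure \<A> \<Longrightarrow> C \<in> \<A> \<Longrightarrow> C' \<in> \<A> \<Longrightarrow> compatible C C'"
  unfolding smooth_structure_def by blast

lemma atlas_cover: "smooth_structure \<A> \<Longrightarrow> \<exists>C\<in>\<A>. p \<in> fst C"
  unfolding smooth_structure_def by blast

lemma chart_left: "q \<in> fst C \<Longrightarrow> is_chart C \<Longrightarrow> chart_inv C (snd C q) = q"
  by (auto simp: is_chart_def homeomorphism_def)

lemma chart_right: "x \<in> snd C ` fst C \<Longrightarrow> is_chart C \<Longrightarrow> chart_inv C x \<in> fst C \<and> snd C (chart_inv C x) = x"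
  by (auto simp: is_chart_def homeomorphism_def)

lemma chart_preimage_open: "is_chart C \<Longrightarrow> open U \<Longrightarrow> open {q \<in> fst C. snd C q \<in> U}"
  using continuous_open_preimage[of "fst C" "snd C" U]
  by (simp add: is_chart_def homeomorphism_def vimage_def Int_def)

lemma chart_image_open:
  assumes "is_chart C" "open V"
  shows "open (snd C ` (fst C \<inter> V))"
proof -
  have "snd C ` (fst C \<inter> V) = (snd C ` fst C) \<inter> chart_inv C -` V"
    using chart_left[OF _ assms(1)] by auto
  also have "open \<dots>"
    by (rule continuous_open_preimage) (use assms in \<open>auto simp: is_chart_def homeomorphism_def\<close>)
  finally show ?thesis .
qed

lemma chart_inv_continuous: "is_chart C \<Longrightarrow> S \<subseteq> snd C ` fst C \<Longrightarrow> continuous_on S (chart_inv C)"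
  by (auto simp: is_chart_def homeomorphism_def intro: continuous_on_subset)

lemma quadratic_form_le_norm:
  fixes A :: "real^'n^'n"
  shows "v \<bullet> (A *v v) \<le> (real CARD('n) * real CARD('n)) * norm A * (norm v)\<^sup>2"
proof -
  have "\<bar>A $ i $ j\<bar> \<le> norm A" for i j
    using component_le_norm_cart[of "A $ i" j] Finite_Cartesian_Product.norm_nth_le[where x=A and i=i] by linarith
  from matrix_entry_bound[OF this, of v]
  have "norm v * norm (A *v v) \<le> norm v * ((real CARD('n) * real CARD('n)) * norm A * norm v)"
    by (intro mult_left_mono) auto
  then show ?thesis
    using norm_cauchy_schwarz[of v "A *v v"] by (simp add: power2_eq_square mult_ac)
qed

text \<open>In the asymptotic chart the points with \<open>|x| \<ge> r\<close> form a closed set of coordinates, but a sequence of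
  them with \<open>|x|\<close> unbounded might converge to a point outside of the end. Lengths exclude this: a limit
  point \<open>p\<close> is joined to some point of the set by a short segment in a chart around \<open>p\<close>. As long
  as the segment stays in the end at \<open>|x| \<ge> R\<close>, its asymptotic coordinates move by less than one,
  since there \<open>h\<close> is at least half of the Euclidean metric. So it never leaves the end, and \<open>p\<close>
  belongs to the end.\<close>

lemma end_far_part_closed:
  fixes \<A> :: "('a::{t2_space,second_countable_topology}, 'n::finite) chart set"
  assumes A: "smooth_structure \<A>" and h: "riemannian_metric \<A> h" and E: "E \<in> \<A>"
    and R: "\<And>x. R \<le> norm x \<Longrightarrow> x \<in> snd E ` fst E"
    and hR: "\<And>x v. R \<le> norm x \<Longrightarrow> 1/2 * (v \<bullet> v) \<le> v \<bullet> (h E x *v v)"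
    and r: "R + 1 \<le> r"
  shows "closed {q \<in> fst E. r \<le> norm (snd E q)}"
proof -
  define Z where "Z = {q \<in> fst E. r \<le> norm (snd E q)}"
  have chE: "is_chart E" by (rule atlas_chart[OF A E])
  have "p \<in> Z" if p: "p \<in> closure Z" for p
  proof -
    have "p \<in> fst E"
    proof -
      obtain C where C: "C \<in> \<A>" "p \<in> fst C" using atlas_cover[OF A] by blast
      have chC: "is_chart C" by (rule atlas_chart[OF A C(1)])
      define SC where "SC = snd C ` fst C"
      define z0 where "z0 = snd C p"
      have oSC: "open SC" using chC by (auto simp: is_chart_def SC_def)
      have z0: "z0 \<in> SC" using C by (auto simp: z0_def SC_def)
      obtain \<delta>1 where \<delta>1: "\<delta>1 > 0" "cball z0 \<delta>1 \<subseteq> SC"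
        using oSC z0 by (meson open_contains_cball)
      have "continuous_on (cball z0 \<delta>1) (h C)"
        using h C(1) \<delta>1(2) unfolding riemannian_metric_def SC_def
        by (meson continuous_on_subset smooth_on_continuous)
      then have "bounded (h C ` cball z0 \<delta>1)"
        by (intro compact_imp_bounded compact_continuous_image) auto
      then obtain M1 where M1: "\<And>z. z \<in> cball z0 \<delta>1 \<Longrightarrow> norm (h C z) \<le> M1"
        unfolding bounded_iff by blast
      define c where "c = real CARD('n) * real CARD('n)"
      have c: "c \<ge> 0" "\<And>B v. v \<bullet> ((B::real^'n^'n) *v v) \<le> c * norm B * (norm v)\<^sup>2"
        unfolding c_def by (simp, rule quadratic_form_le_norm)
      define M where "M = c * M1"
      have hM: "v \<bullet> (h C z *v v) \<le> M * (norm v)\<^sup>2" if "z \<in> cball z0 \<delta>1" for z v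
      proof -
        have "c * norm (h C z) * (norm v)\<^sup>2 \<le> c * M1 * (norm v)\<^sup>2"
          by (intro mult_right_mono mult_left_mono M1 that c) auto
        then show ?thesis using c(2)[of v "h C z"] by (simp add: M_def)
      qed
      have M0: "M \<ge> 0"
      proof -
        have "0 \<le> norm (h C z0)" by simp
        also have "\<dots> \<le> M1" using \<delta>1(1) by (intro M1) auto
        finally show ?thesis using c(1) by (simp add: M_def)
      qed
      define \<kappa> where "\<kappa> = sqrt (2 * M)"
      have \<kappa>: "\<kappa> \<ge> 0" using M0 by (simp add: \<kappa>_def)
      define \<delta> where "\<delta> = min \<delta>1 (1 / (\<kappa> + 1))"
      have \<delta>: "\<delta> > 0" "\<delta> \<le> \<delta>1" using \<delta>1(1) \<kappa> by (auto simp: \<delta>_def)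
      have \<kappa>\<delta>: "\<kappa> * \<delta> < 1"
      proof -
        have "\<kappa> * \<delta> \<le> \<kappa> * (1 / (\<kappa> + 1))" using \<kappa> by (intro mult_left_mono) (auto simp: \<delta>_def)
        also have "\<dots> < 1" using \<kappa> by simp
        finally show ?thesis .
      qed
      have "open {q \<in> fst C. snd C q \<in> ball z0 \<delta>}" by (rule chart_preimage_open[OF chC]) simp
      moreover have "p \<in> {q \<in> fst C. snd C q \<in> ball z0 \<delta>}" using C \<delta> by (simp add: z0_def)
      ultimately obtain q1 where q1: "q1 \<in> Z" "q1 \<in> fst C" "snd C q1 \<in> ball z0 \<delta>"
        using p open_Int_closure_eq_empty[of "{q \<in> fst C. snd C q \<in> ball z0 \<delta>}" Z] by blast
      define z1 where "z1 = snd C q1"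
      define w1 where "w1 = snd E q1"
      have w1: "R + 1 \<le> norm w1" using q1(1) r by (simp add: Z_def w1_def)
      define \<gamma> where "\<gamma> t = z1 + t *\<^sub>R (z0 - z1)" for t :: real
      have \<gamma>cont: "continuous_on S \<gamma>" for S unfolding \<gamma>_def by (intro continuous_intros)
      have \<gamma>in: "\<gamma> t \<in> cball z0 \<delta>1" if "t \<in> {0..1}" for t
      proof -
        have "\<gamma> t = (1 - t) *\<^sub>R z1 + t *\<^sub>R z0" by (simp add: \<gamma>_def algebra_simps)
        moreover have "z1 \<in> cball z0 \<delta>1" "z0 \<in> cball z0 \<delta>1" using q1(3) \<delta> by (auto simp: z1_def)
        ultimately show ?thesis using that convexD_alt[OF convex_cball, of z1 z0 \<delta>1 z0 t] by auto
      qed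
      have \<gamma>SC: "\<gamma> t \<in> SC" if "t \<in> {0..1}" for t using \<gamma>in[OF that] \<delta>1(2) by blast
      define \<tau> where "\<tau> = transition C E"
      have \<tau>: "\<tau> z = snd E (chart_inv C z)" for z by (simp add: \<tau>_def transition_def)
      define W where "W = snd C ` (fst C \<inter> fst E)"
      have oW: "open W" unfolding W_def
        using chart_image_open[OF chC] chE by (auto simp: is_chart_def)
      have "compatible C E" by (rule atlas_compatible[OF A C(1) E])
      then have sm: "smooth_on \<tau> W" by (simp add: compatible_def \<tau>_def W_def)
      have W_iff: "z \<in> W \<longleftrightarrow> z \<in> SC \<and> chart_inv C z \<in> fst E" for z
        unfolding W_def SC_def using chart_left[OF _ chC] chart_right[OF _ chC] by (auto intro!: image_eqI)
      define D where "D z = frechet_derivative \<tau> (at z)" for z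
      have D: "(\<tau> has_derivative D z) (at z)" if "z \<in> W" for z
        using smooth_on_differentiable[OF sm that] by (simp add: D_def frechet_derivative_works)
      have Dbound: "norm (D z v) \<le> \<kappa> * norm v" if "z \<in> W" "z \<in> cball z0 \<delta>1" "R \<le> norm (\<tau> z)" for z v
      proof -
        have "1/2 * (D z v \<bullet> D z v) \<le> D z v \<bullet> (h E (\<tau> z) *v D z v)" by (rule hR) fact
        also have "\<dots> = v \<bullet> (h C z *v v)"
          using h C(1) E that(1) unfolding riemannian_metric_def Let_def D_def \<tau>_def W_def by metis
        also have "\<dots> \<le> M * (norm v)\<^sup>2" by (rule hM) fact
        finally have "(norm (D z v))\<^sup>2 \<le> 2 * M * (norm v)\<^sup>2" by (simp add: dot_square_norm)
        then have "(norm (D z v))\<^sup>2 \<le> (\<kappa> * norm v)\<^sup>2" using M0 by (simp add: \<kappa>_def power_mult_distrib)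
        then show ?thesis using \<kappa> by (meson mult_nonneg_nonneg norm_ge_zero power2_le_imp_le)
      qed
      \<comment> \<open>It suffices that the segment \<open>\<gamma>\<close> never leaves the open set \<open>W'\<close>; otherwise consider the first exit
        time \<open>t0\<close>.\<close>
      define W' where "W' = W \<inter> \<tau> -` ball w1 1"
      have oW': "open W'" unfolding W'_def
        by (rule continuous_open_preimage) (use oW smooth_on_continuous[OF sm] in auto)
      have "\<gamma> 1 \<in> W'"
      proof (rule ccontr)
        assume notin: "\<gamma> 1 \<notin> W'"
        define Bd where "Bd = {0..1} \<inter> \<gamma> -` (- W')"
        have "closed Bd" unfolding Bd_def
          by (rule continuous_closed_preimage) (use \<gamma>cont oW' in auto)
        moreover have "bounded Bd" by (rule bounded_subset[of "{0..1::real}"]) (auto simp: Bd_def)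
        ultimately have "compact Bd" by (simp add: compact_eq_bounded_closed)
        moreover have "1 \<in> Bd" using notin by (simp add: Bd_def)
        then have "Bd \<noteq> {}" by (rule ex_in_conv[THEN iffD1, OF exI])
        ultimately obtain t0 where t0: "t0 \<in> Bd" "\<And>t. t \<in> Bd \<Longrightarrow> t0 \<le> t"
          using compact_attains_inf[of Bd] by metis
        have before: "\<gamma> s \<in> W'" if "0 \<le> s" "s < t0" for s
        proof (rule ccontr)
          assume "\<gamma> s \<notin> W'"
          then have "s \<in> Bd" using that t0(1) by (auto simp: Bd_def)
          then show False using t0(2) that by force
        qed
        have "\<gamma> 0 \<in> W'"
          using q1 unfolding W'_def by (auto simp: \<gamma>_def W_def z1_def Z_def w1_def \<tau> chart_left[OF _ chC])
        then have t0': "0 < t0" "t0 \<le> 1" using t0(1) by (auto simp: Bd_def less_le)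
        \<comment> \<open>The compact, hence closed, coordinate ball \<open>P\<close> contains the segment before \<open>t0\<close>, so the point at
          \<open>t0\<close> is still in the end.\<close>
        define P where "P = chart_inv E ` cball w1 1"
        have farE: "R \<le> norm w" if "w \<in> cball w1 1" for w
          using that w1 norm_triangle_ineq2[of w1 w] by (simp add: dist_norm)
        have "compact P" unfolding P_def
          by (intro compact_continuous_image chart_inv_continuous chE) (auto intro: R farE)
        then have clP: "closed P" by (rule compact_imp_closed)
        have "chart_inv C (\<gamma> t0) \<in> P"
        proof (rule continuous_endpoint_in_closed[OF t0'(1) _ clP])
          show "continuous_on {0..t0} (\<lambda>t. chart_inv C (\<gamma> t))"
            by (rule continuous_on_compose2[OF chart_inv_continuous[OF chC order_refl] \<gamma>cont])
               (use \<gamma>SC t0' in \<open>auto simp: SC_def\<close>)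
          fix s assume s: "0 \<le> s" "s < t0"
          have "\<gamma> s \<in> W'" by (rule before[OF s])
          then have "chart_inv C (\<gamma> s) \<in> fst E" "snd E (chart_inv C (\<gamma> s)) \<in> cball w1 1"
            by (auto simp: W'_def W_iff \<tau>)
          then show "chart_inv C (\<gamma> s) \<in> P"
            unfolding P_def using chart_left[OF _ chE] by (metis image_eqI)
        qed
        then obtain w where w: "w \<in> cball w1 1" "chart_inv C (\<gamma> t0) = chart_inv E w" by (auto simp: P_def)
        have wE: "w \<in> snd E ` fst E" using farE[OF w(1)] by (rule R)
        have t0W: "\<gamma> t0 \<in> W" "\<tau> (\<gamma> t0) \<in> cball w1 1"
          using chart_right[OF wE chE] w t0' \<gamma>SC by (auto simp: W_iff \<tau>)
        have upto: "\<gamma> s \<in> W \<and> \<tau> (\<gamma> s) \<in> cball w1 1" if "s \<in> {0..t0}" for s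
        proof (cases "s = t0")
          case True then show ?thesis using t0W by simp
        next
          case False
          then have "\<gamma> s \<in> W'" using that by (intro before) auto
          then show ?thesis by (auto simp: W'_def)
        qed
        have "norm (\<tau> (\<gamma> t0) - \<tau> (\<gamma> 0)) \<le> (\<kappa> * norm (z0 - z1)) * norm (t0 - 0)"
        proof (rule differentiable_bound[of "{0..t0}"])
          show "convex {0..t0}" by simp
          fix s assume s: "s \<in> {0..t0}"
          have "(\<gamma> has_derivative (\<lambda>u. u *\<^sub>R (z0 - z1))) (at s within {0..t0})"
            unfolding \<gamma>_def by (rule derivative_eq_intros refl | simp)+
          from has_derivative_compose[OF this D]
          show "((\<lambda>s. \<tau> (\<gamma> s)) has_derivative (\<lambda>u. D (\<gamma> s) (u *\<^sub>R (z0 - z1)))) (at s within {0..t0})"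
            using upto[OF s] by blast
          show "onorm (\<lambda>u. D (\<gamma> s) (u *\<^sub>R (z0 - z1))) \<le> \<kappa> * norm (z0 - z1)"
          proof (rule onorm_le)
            fix u
            have "norm (D (\<gamma> s) (u *\<^sub>R (z0 - z1))) \<le> \<kappa> * norm (u *\<^sub>R (z0 - z1))"
            proof (rule Dbound)
              show "\<gamma> s \<in> W" "R \<le> norm (\<tau> (\<gamma> s))" using upto[OF s] farE by blast+
              show "\<gamma> s \<in> cball z0 \<delta>1" using s t0' by (intro \<gamma>in) auto
            qed
            then show "norm (D (\<gamma> s) (u *\<^sub>R (z0 - z1))) \<le> \<kappa> * norm (z0 - z1) * norm u"
              by (simp add: mult_ac)
          qed
        qed (use t0' in auto)
        also have "\<tau> (\<gamma> 0) = w1" using q1 by (simp add: \<gamma>_def \<tau> z1_def w1_def chart_left[OF _ chC])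
        also have "(\<kappa> * norm (z0 - z1)) * norm (t0 - 0) \<le> (\<kappa> * norm (z0 - z1)) * 1"
          using t0' \<kappa> by (intro mult_left_mono) auto
        also have "\<dots> \<le> \<kappa> * \<delta>" using q1(3) \<kappa> by (simp add: mult_left_mono z1_def dist_norm)
        finally have "norm (\<tau> (\<gamma> t0) - w1) < 1" using \<kappa>\<delta> by simp
        then have "\<gamma> t0 \<in> W'" using t0W by (simp add: W'_def dist_norm norm_minus_commute)
        then show False using t0(1) by (simp add: Bd_def)
      qed
      then have "z0 \<in> W" by (simp add: W'_def \<gamma>_def)
      then show "p \<in> fst E" using chart_left[OF C(2) chC] by (simp add: W_iff z0_def)
    qed
    show "p \<in> Z"
    proof (rule ccontr)
      assume "p \<notin> Z"
      then have "p \<in> {q \<in> fst E. snd E q \<in> ball 0 r}" using \<open>p \<in> fst E\<close> by (auto simp: Z_def)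
      moreover have "open {q \<in> fst E. snd E q \<in> ball 0 r}" by (rule chart_preimage_open[OF chE]) simp
      moreover have "{q \<in> fst E. snd E q \<in> ball 0 r} \<inter> Z = {}" by (auto simp: Z_def)
      ultimately show False
        using p open_Int_closure_eq_empty[of "{q \<in> fst E. snd E q \<in> ball 0 r}" Z] by blast
    qed
  qed
  then have "closure Z \<subseteq> Z" by blast
  then show ?thesis unfolding Z_def[symmetric] by (simp add: closure_subset_eq)
qed

section \<open>Topology of the truncated manifold\<close>

text \<open>A space that consists of \<open>K\<close> and finitely many disjoint ends, each with a chart whose image contains
  all \<open>x\<close> with \<open>|x| \<ge> R\<close> and whose far parts are closed in the whole space.\<close>

locale exhausted_by_ends =
  fixes K :: "'a::{t2_space,second_countable_topology} set" and m :: nat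
    and X :: "nat \<Rightarrow> ('a, 'n::finite) chart" and R :: real
  assumes charts: "\<And>k. k \<in> {1..m} \<Longrightarrow> is_chart (X k)"
    and ends: "- K = (\<Union>k\<in>{1..m}. fst (X k))" "disjoint_family_on (\<lambda>k. fst (X k)) {1..m}"
    and R0: "0 < R"
    and image: "\<And>k x. k \<in> {1..m} \<Longrightarrow> R \<le> norm x \<Longrightarrow> x \<in> snd (X k) ` fst (X k)"
    and far_closed: "\<And>k r. k \<in> {1..m} \<Longrightarrow> R \<le> r \<Longrightarrow> closed {q \<in> fst (X k). r \<le> norm (snd (X k) q)}"
begin

abbreviation rad :: "nat \<Rightarrow> 'a \<Rightarrow> real" where "rad k q \<equiv> norm (snd (X k) q)"

lemma end_unique: "k \<in> {1..m} \<Longrightarrow> l \<in> {1..m} \<Longrightarrow> q \<in> fst (X k) \<Longrightarrow> q \<in> fst (X l) \<Longrightarrow> k = l"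
  using ends(2) unfolding disjoint_family_on_def by blast

lemma asymptotic_domain_eq:
  assumes "0 \<le> r"
  shows "asymptotic_domain K m X r = - (\<Union>k\<in>{1..m}. {q \<in> fst (X k). r \<le> rad k q})"
proof -
  have sq: "(rad k q)\<^sup>2 < r\<^sup>2 \<longleftrightarrow> \<not> r \<le> rad k q" for k q
    using assms abs_le_square_iff[of r "rad k q"] by (simp flip: not_le)
  have "q \<in> K \<or> (\<exists>k\<in>{1..m}. q \<in> fst (X k) \<and> \<not> r \<le> rad k q)
      \<longleftrightarrow> \<not> (\<exists>k\<in>{1..m}. q \<in> fst (X k) \<and> r \<le> rad k q)" for q
  proof (cases "q \<in> K")
    case True
    then have "q \<notin> (\<Union>k\<in>{1..m}. fst (X k))" using ends(1) by blast
    then show ?thesis using True by blast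
  next
    case False
    then obtain l where "l \<in> {1..m}" "q \<in> fst (X l)" using ends(1) by blast
    then show ?thesis using False end_unique by blast
  qed
  then show ?thesis unfolding asymptotic_domain_def sq by blast
qed

text \<open>The closed counterpart of \<open>asymptotic_domain\<close>, with the condition \<open>|x| \<le> s\<close> in each end.\<close>

definition sublevel :: "real \<Rightarrow> 'a set" where
  "sublevel s = {q. \<forall>k\<in>{1..m}. q \<in> fst (X k) \<longrightarrow> rad k q \<le> s}"

lemma closed_sublevel: "closed (sublevel s)"
proof -
  have "open {q \<in> fst (X k). snd (X k) q \<in> - cball 0 s}" if "k \<in> {1..m}" for k
    by (rule chart_preimage_open[OF charts[OF that]]) (simp add: open_Compl)
  then have "open (\<Union>k\<in>{1..m}. {q \<in> fst (X k). snd (X k) q \<in> - cball 0 s})" by blast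
  moreover have "sublevel s = - (\<Union>k\<in>{1..m}. {q \<in> fst (X k). snd (X k) q \<in> - cball 0 s})"
    by (fastforce simp: sublevel_def)
  ultimately show ?thesis by (simp add: closed_def)
qed

lemma open_domain:
  assumes "R \<le> r"
  shows "open (asymptotic_domain K m X r)"
proof -
  have "closed (\<Union>k\<in>{1..m}. {q \<in> fst (X k). r \<le> rad k q})"
    using far_closed assms by (intro closed_UN) auto
  then show ?thesis using R0 assms by (subst asymptotic_domain_eq) (auto intro: open_Compl simp del: Compl_UN)
qed

text \<open>Pushing the far points radially to the sphere \<open>|x| = s\<close> retracts the whole space onto the sublevel set.
  Unlike an argument with connected spheres, this also covers dimension one.\<close>

lemma connected_sublevel:
  assumes s: "R \<le> s" and con: "connected (UNIV :: 'a set)"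
  shows "connected (sublevel s)" "sublevel s \<noteq> {}"
proof -
  have spos: "0 < s" using s R0 by linarith
  define retr where "retr k q = chart_inv (X k) ((s / rad k q) *\<^sub>R snd (X k) q)" for k q
  define far where "far k = {q \<in> fst (X k). s \<le> rad k q}" for k
  define \<rho> where "\<rho> q = (if q \<in> sublevel s then q else retr (THE k. k \<in> {1..m} \<and> q \<in> fst (X k)) q)" for q
  have retr: "retr k q \<in> fst (X k) \<and> rad k (retr k q) = s" if "k \<in> {1..m}" "q \<in> far k" for k q
  proof -
    have "rad k q > 0" using that(2) spos by (auto simp: far_def)
    then have "norm ((s / rad k q) *\<^sub>R snd (X k) q) = s" using spos by simp
    then show ?thesis using chart_right[OF image charts, OF that(1) _ that(1)] s unfolding retr_def by metis
  qed
  have \<rho>_far: "\<rho> q = retr k q" if k: "k \<in> {1..m}" and q: "q \<in> far k" for k q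
  proof (cases "q \<in> sublevel s")
    case True
    then have "rad k q = s" using k q unfolding sublevel_def far_def by (simp add: antisym)
    moreover have "q \<in> fst (X k)" using q by (simp add: far_def)
    ultimately have "retr k q = q" using spos chart_left[OF _ charts[OF k], of q] by (simp add: retr_def)
    then show ?thesis using True by (simp add: \<rho>_def)
  next
    case False
    have "(THE l. l \<in> {1..m} \<and> q \<in> fst (X l)) = k"
    proof (rule the_equality)
      show "k \<in> {1..m} \<and> q \<in> fst (X k)" using k q by (simp add: far_def)
      then show "l = k" if "l \<in> {1..m} \<and> q \<in> fst (X l)" for l using that end_unique by blast
    qed
    then show ?thesis using False by (simp only: \<rho>_def if_False)
  qed
  have cover: "q \<in> sublevel s \<or> (\<exists>k\<in>{1..m}. q \<in> far k)" for q
    by (force simp: sublevel_def far_def)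
  have "continuous_on (sublevel s) \<rho>"
    by (rule continuous_on_eq[OF continuous_on_id]) (simp add: \<rho>_def)
  moreover have "continuous_on (\<Union>k\<in>{1..m}. far k) \<rho>"
  proof (rule continuous_on_closed_Union)
    fix k assume k: "k \<in> {1..m}"
    show "closed (far k)" using far_closed[OF k s] by (simp add: far_def)
    have c: "continuous_on (far k) (snd (X k))"
      using charts[OF k] by (auto simp: is_chart_def homeomorphism_def far_def intro: continuous_on_subset)
    have "continuous_on (far k) (retr k)" unfolding retr_def
    proof (rule continuous_on_compose2[OF chart_inv_continuous[OF charts[OF k] order_refl]])
      show "continuous_on (far k) (\<lambda>q. (s / rad k q) *\<^sub>R snd (X k) q)"
        using spos by (intro continuous_intros c) (auto simp: far_def)
      show "(\<lambda>q. (s / rad k q) *\<^sub>R snd (X k) q) ` far k \<subseteq> snd (X k) ` fst (X k)"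
      proof (rule image_subsetI)
        fix q assume "q \<in> far k"
        then have "rad k q > 0" using spos by (auto simp: far_def)
        then have "norm ((s / rad k q) *\<^sub>R snd (X k) q) = s" using spos by simp
        then show "(s / rad k q) *\<^sub>R snd (X k) q \<in> snd (X k) ` fst (X k)"
          using s by (intro image k) simp
      qed
    qed
    then show "continuous_on (far k) \<rho>"
      by (rule continuous_on_eq) (simp add: \<rho>_far[OF k])
  qed simp
  moreover have "closed (\<Union>k\<in>{1..m}. far k)"
    using far_closed[OF _ s] by (intro closed_UN) (auto simp: far_def)
  ultimately have "continuous_on (sublevel s \<union> (\<Union>k\<in>{1..m}. far k)) \<rho>"
    by (intro continuous_on_closed_Un closed_sublevel)
  moreover have "sublevel s \<union> (\<Union>k\<in>{1..m}. far k) = UNIV" using cover by auto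
  ultimately have "continuous_on UNIV \<rho>" by simp
  then have "connected (\<rho> ` UNIV)" using con by (rule connected_continuous_image)
  moreover have "\<rho> ` UNIV = sublevel s"
  proof
    show "sublevel s \<subseteq> \<rho> ` UNIV"
    proof
      fix q assume "q \<in> sublevel s"
      then have "q = \<rho> q" by (simp add: \<rho>_def)
      then show "q \<in> \<rho> ` UNIV" by (rule image_eqI) simp
    qed
    show "\<rho> ` UNIV \<subseteq> sublevel s"
    proof (rule image_subsetI)
      fix q
      show "\<rho> q \<in> sublevel s"
      proof (cases "q \<in> sublevel s")
        case True then show ?thesis by (simp add: \<rho>_def)
      next
        case False
        then obtain k where k: "k \<in> {1..m}" "q \<in> far k" using cover by blast
        show ?thesis unfolding sublevel_def \<rho>_far[OF k]
          using retr[OF k] end_unique[OF k(1)] by blast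
      qed
    qed
  qed
  ultimately show "connected (sublevel s)" "sublevel s \<noteq> {}" by auto
qed

lemma connected_domain:
  assumes r: "R < r" and con: "connected (UNIV :: 'a set)"
  shows "connected (asymptotic_domain K m X r)"
proof -
  have mono: "s \<le> t \<Longrightarrow> sublevel s \<subseteq> sublevel t" for s t
    by (fastforce simp: sublevel_def)
  have "connected (\<Union>(sublevel ` {R..<r}))"
  proof (rule connected_Union)
    show "\<And>S. S \<in> sublevel ` {R..<r} \<Longrightarrow> connected S"
      using connected_sublevel(1)[OF _ con] by auto
    have "sublevel R \<subseteq> \<Inter>(sublevel ` {R..<r})" using mono[of R] by fastforce
    then show "\<Inter>(sublevel ` {R..<r}) \<noteq> {}" using connected_sublevel(2)[OF order_refl con] by blast
  qed
  also have "\<Union>(sublevel ` {R..<r}) = asymptotic_domain K m X r"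
  proof -
    have "(\<exists>s\<in>{R..<r}. q \<in> sublevel s) \<longleftrightarrow> (\<forall>k\<in>{1..m}. q \<in> fst (X k) \<longrightarrow> rad k q < r)" for q
    proof
      assume "\<exists>s\<in>{R..<r}. q \<in> sublevel s"
      then obtain s where "s < r" "q \<in> sublevel s" by auto
      then show "\<forall>k\<in>{1..m}. q \<in> fst (X k) \<longrightarrow> rad k q < r"
        unfolding sublevel_def using order.strict_trans1 by blast
    next
      assume *: "\<forall>k\<in>{1..m}. q \<in> fst (X k) \<longrightarrow> rad k q < r"
      show "\<exists>s\<in>{R..<r}. q \<in> sublevel s"
      proof (cases "\<exists>k\<in>{1..m}. q \<in> fst (X k)")
        case True
        then obtain k where k: "k \<in> {1..m}" "q \<in> fst (X k)" by blast
        have "rad l q \<le> max R (rad k q)" if "l \<in> {1..m}" "q \<in> fst (X l)" for l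
          using end_unique[OF k(1) that(1) k(2) that(2)] by simp
        then have "q \<in> sublevel (max R (rad k q))" by (simp add: sublevel_def)
        moreover have "max R (rad k q) \<in> {R..<r}" using bspec[OF * k(1)] k(2) r by simp
        ultimately show ?thesis by blast
      next
        case False
        then have "q \<in> sublevel R" unfolding sublevel_def by blast
        moreover have "R \<in> {R..<r}" using r by simp
        ultimately show ?thesis by blast
      qed
    qed
    moreover have "0 \<le> r" using r R0 by linarith
    ultimately show ?thesis unfolding asymptotic_domain_eq[OF \<open>0 \<le> r\<close>] not_le[symmetric] by blast
  qed
  finally show ?thesis .
qed

lemma frontier_domain:
  assumes r: "R < r"
  shows "frontier (asymptotic_domain K m X r) = (\<Union>k\<in>{1..m}. {q \<in> fst (X k). rad k q = r})"
proof -
  let ?D = "asymptotic_domain K m X r"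
  have r0: "0 < r" using r R0 by linarith
  note D = asymptotic_domain_eq[OF less_imp_le[OF r0]]
  have "?D \<subseteq> sublevel r" unfolding D sublevel_def by force
  then have cl: "closure ?D \<subseteq> sublevel r" by (rule closure_minimal[OF _ closed_sublevel])
  have "interior ?D = ?D" using open_domain r by (simp add: interior_open)
  then have fr: "frontier ?D = closure ?D - ?D" by (simp add: frontier_def)
  have "q \<in> closure ?D" if k: "k \<in> {1..m}" and q: "q \<in> fst (X k)" "rad k q = r" for k q
  proof -
    define c where "c t = chart_inv (X k) (t *\<^sub>R snd (X k) q)" for t :: real
    have im: "t *\<^sub>R snd (X k) q \<in> snd (X k) ` fst (X k)" if "R / r \<le> t" for t
    proof (rule image[OF k])
      have "R \<le> t * r" using that r0 by (simp add: pos_divide_le_eq)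
      moreover have "0 \<le> t" using that R0 r0 by (meson divide_nonneg_nonneg less_imp_le order_trans)
      ultimately show "R \<le> norm (t *\<^sub>R snd (X k) q)" using q by simp
    qed
    have "c 1 \<in> closure ?D"
    proof (rule continuous_endpoint_in_closed[of "R / r" 1])
      show "R / r < 1" using r r0 by simp
      show "continuous_on {R / r..1} c" unfolding c_def
        by (rule continuous_on_compose2[OF chart_inv_continuous[OF charts[OF k] order_refl]])
           (use im in \<open>auto intro!: continuous_intros\<close>)
      fix t assume t: "R / r \<le> t" "t < 1"
      have "0 \<le> t" using t R0 r0 by (meson divide_nonneg_nonneg less_imp_le order_trans)
      then have "c t \<in> fst (X k)" "rad k (c t) < r"
        using chart_right[OF im[OF t(1)] charts[OF k]] q t r0 by (auto simp: c_def)
      then have "c t \<in> ?D" unfolding D using end_unique[OF k] not_le by blast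
      then show "c t \<in> closure ?D" using closure_subset by blast
    qed simp
    then show ?thesis using chart_left[OF q(1) charts[OF k]] by (simp add: c_def)
  qed
  then have "{q \<in> fst (X k). rad k q = r} \<subseteq> closure ?D - ?D" if "k \<in> {1..m}" for k
    using that unfolding D by auto
  moreover have "\<exists>k\<in>{1..m}. q \<in> fst (X k) \<and> rad k q = r" if qD: "q \<in> closure ?D - ?D" for q
  proof -
    obtain k where k: "k \<in> {1..m}" "q \<in> fst (X k)" "r \<le> rad k q" using qD unfolding D by blast
    moreover have "rad k q \<le> r" using cl qD k unfolding sublevel_def by blast
    ultimately show ?thesis using antisym by blast
  qed
  ultimately show ?thesis unfolding fr by blast
qed

end

section \<open>Defining functions of coordinate spheres\<close>

lemma Ck_on_cong_open:
  assumes "open S"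
  shows "(\<And>z. z \<in> S \<Longrightarrow> f z = g z) \<Longrightarrow> Ck_on k f S = Ck_on k g S"
proof (induction k arbitrary: f g)
  case 0
  then show ?case by (simp cong: continuous_on_cong)
next
  case (Suc k)
  have "f differentiable at x \<longleftrightarrow> g differentiable at x" if "x \<in> S" for x
    unfolding differentiable_def using has_derivative_cong_open[OF assms that Suc.prems] by simp
  moreover have "Ck_on k (\<lambda>x. frechet_derivative f (at x) v) S = Ck_on k (\<lambda>x. frechet_derivative g (at x) v) S" for v
    by (rule Suc.IH) (simp add: frechet_derivative_cong_open[OF assms _ Suc.prems])
  ultimately show ?case by simp
qed

lemma Ck_on_square_norm: "Ck_on 2 (\<lambda>z::real^'n. c - z \<bullet> z) S"
proof -
  have 1: "frechet_derivative (\<lambda>z::real^'n. c - z \<bullet> z) (at x) = (\<lambda>w. - 2 * (x \<bullet> w))" for x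
    by (rule frechet_derivative_at[OF has_derivative_square_norm, symmetric])
  have 2: "((\<lambda>x::real^'n. - 2 * (x \<bullet> v)) has_derivative (\<lambda>w. - 2 * (w \<bullet> v))) (at x)" for v x
    by (intro has_derivative_mult_right has_derivative_inner_left has_derivative_ident)
  have 3: "frechet_derivative (\<lambda>x::real^'n. - 2 * (x \<bullet> v)) (at x) = (\<lambda>w. - 2 * (w \<bullet> v))" for v x
    by (rule frechet_derivative_at[OF 2, symmetric])
  have "Ck_on (Suc (Suc 0)) (\<lambda>z::real^'n. c - z \<bullet> z) S"
    unfolding Ck_on.simps 1 3
    using has_derivative_square_norm 2 by (auto intro: differentiableI)
  then show ?thesis by (simp only: numeral_2_eq_2)
qed

section \<open>Asymptotic decay\<close>

lemma eventually_powr_decay: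
  fixes f :: "'a::real_normed_vector \<Rightarrow> real"
  assumes f: "f \<in> O[at_infinity](\<lambda>x. 1 / norm x powr (p + a))" and p: "p > 0" and e: "e > 0"
  shows "\<forall>\<^sub>F x in at_infinity. \<bar>f x\<bar> \<le> e / norm x powr a"
proof -
  from f obtain c where c: "c > 0" "\<forall>\<^sub>F x in at_infinity. norm (f x) \<le> c * norm (1 / norm x powr (p + a))"
    by (rule landau_o.bigE)
  have "\<forall>\<^sub>F x::'a in at_infinity. c / e \<le> norm x powr p"
    unfolding eventually_at_infinity
  proof (intro exI allI impI)
    fix x :: 'a assume "(c / e) powr (1 / p) \<le> norm x"
    then have "((c / e) powr (1 / p)) powr p \<le> norm x powr p"
      using p by (intro powr_mono2) auto
    then show "c / e \<le> norm x powr p" using p c(1) e by (simp add: powr_powr)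
  qed
  with c(2) show ?thesis
  proof eventually_elim
    case (elim x)
    have "0 < c / e" using c(1) e by simp
    then have pos: "0 < norm x powr p" using elim(2) by linarith
    have "\<bar>f x\<bar> \<le> (c / norm x powr p) / norm x powr a" using elim(1) by (simp add: powr_add)
    also have "\<dots> \<le> e / norm x powr a"
    proof (rule divide_right_mono)
      show "c / norm x powr p \<le> e"
        using elim(2) e pos by (simp add: field_simps)
    qed simp
    finally show ?case .
  qed
qed

lemma asymptotic_chart_eventually:
  fixes C :: "('a, 'n::finite) chart"
  assumes C: "asymptotic_chart h \<omega> C" and e: "e > 0"
  shows "\<forall>\<^sub>F x in at_infinity. x \<in> snd C ` fst C \<and> (\<forall>i j k.
     \<bar>h C x $ i $ j - (if i = j then 1 else 0)\<bar> \<le> e \<and>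
     \<bar>pd k (\<lambda>x. h C x $ i $ j) x\<bar> \<le> e / norm x \<and>
     \<bar>pd i (\<lambda>x. \<omega> C x $ j) x - pd j (\<lambda>x. \<omega> C x $ i) x\<bar> \<le> e / norm x)"
proof -
  obtain p q where pq: "p > 0" "q > 0"
    and O: "\<And>i j k. (\<lambda>x. h C x $ i $ j - (if i = j then 1 else 0)) \<in> O[at_infinity](\<lambda>x. 1 / norm x powr p)"
      "\<And>i j k. (\<lambda>x. pd k (\<lambda>x. h C x $ i $ j) x) \<in> O[at_infinity](\<lambda>x. 1 / norm x powr (p + 1))"
      "\<And>i j k. (\<lambda>x. pd i (\<lambda>x. \<omega> C x $ j) x - pd j (\<lambda>x. \<omega> C x $ i) x)
          \<in> O[at_infinity](\<lambda>x. 1 / norm x powr (q + 1))"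
    using C unfolding asymptotic_chart_def by blast
  have 0: "\<forall>\<^sub>F x in at_infinity. x \<in> snd C ` fst C"
    using C unfolding asymptotic_chart_def by blast
  have nz: "\<forall>\<^sub>F x::real^'n in at_infinity. x \<noteq> 0"
    unfolding eventually_at_infinity by (rule exI[of _ 1]) auto
  have "\<forall>\<^sub>F x in at_infinity. \<bar>h C x $ i $ j - (if i = j then 1 else 0)\<bar> \<le> e \<and>
     \<bar>pd k (\<lambda>x. h C x $ i $ j) x\<bar> \<le> e / norm x \<and>
     \<bar>pd i (\<lambda>x. \<omega> C x $ j) x - pd j (\<lambda>x. \<omega> C x $ i) x\<bar> \<le> e / norm x" for i j k
    using nz eventually_powr_decay[of _ p 0, simplified, OF O(1)[of i j] pq(1) e]
      eventually_powr_decay[OF O(2)[of k i j] pq(1) e] eventually_powr_decay[OF O(3)[of i j] pq(2) e]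
    by eventually_elim simp
  then have "\<forall>\<^sub>F x in at_infinity. \<forall>i j k. \<bar>h C x $ i $ j - (if i = j then 1 else 0)\<bar> \<le> e \<and>
     \<bar>pd k (\<lambda>x. h C x $ i $ j) x\<bar> \<le> e / norm x \<and>
     \<bar>pd i (\<lambda>x. \<omega> C x $ j) x - pd j (\<lambda>x. \<omega> C x $ i) x\<bar> \<le> e / norm x"
    by (intro eventually_all_finite)
  with 0 show ?thesis by (rule eventually_conj)
qed

section \<open>Strong convexity of large coordinate spheres\<close>

lemma coordinate_sphere_hessian_neg:
  fixes \<A> :: "('a::{t2_space,second_countable_topology}, 'n::finite) chart set"
  assumes M: "randers_manifold \<A> h \<omega>" and C: "C \<in> \<A>" and xC: "x \<in> snd C ` fst C" and xnz: "x \<noteq> 0"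
    and e: "e = 1 / (16 * real CARD('n) ^ 3)"
    and near: "\<And>i j k. \<bar>h C x $ i $ j - (if i = j then 1 else 0)\<bar> \<le> e \<and>
       \<bar>pd k (\<lambda>x. h C x $ i $ j) x\<bar> \<le> e / norm x \<and>
       \<bar>pd i (\<lambda>x. \<omega> C x $ j) x - pd j (\<lambda>x. \<omega> C x $ i) x\<bar> \<le> e / norm x"
    and f: "\<And>z. z \<in> snd C ` fst C \<Longrightarrow> f z = c - z \<bullet> z"
    and y0: "y \<noteq> 0" and xy: "x \<bullet> y = 0"
  shows "chern_hessian (randers_metric h \<omega> C) f x y y y < 0"
proof -
  let ?S = "snd C ` fst C"
  have st: "smooth_structure \<A>" and h: "riemannian_metric \<A> h" and w: "one_form \<A> \<omega>"
    and cov: "covector_norm (h C x) (\<omega> C x) < 1"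
    using M C xC unfolding randers_manifold_def by blast+
  have oS: "open ?S" using atlas_chart[OF st C] by (simp add: is_chart_def)
  have "smooth_on (h C) ?S" "smooth_on (\<omega> C) ?S"
    using h w C unfolding riemannian_metric_def one_form_def by blast+
  then have d: "(h C has_derivative frechet_derivative (h C) (at x)) (at x)"
    "(\<omega> C has_derivative frechet_derivative (\<omega> C) (at x)) (at x)"
    using smooth_on_differentiable xC by (metis frechet_derivative_works)+
  have pdh: "pd k (\<lambda>x. h C x $ i $ j) x = frechet_derivative (h C) (at x) (axis k 1) $ i $ j" for i j k
    by (rule pd_eq_has_derivative) (intro has_derivative_vec_nth d)
  have pdw: "pd k (\<lambda>x. \<omega> C x $ i) x = frechet_derivative (\<omega> C) (at x) (axis k 1) $ i" for i k
    by (rule pd_eq_has_derivative) (intro has_derivative_vec_nth d)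
  interpret randers_field "h C" "\<omega> C" ?S "frechet_derivative (h C) (at x)" "frechet_derivative (\<omega> C) (at x)" x y
  proof
    show "pos_sym (h C z)" if "z \<in> ?S" for z
      using h C that unfolding riemannian_metric_def pos_sym_def by blast
  qed (use oS xC d y0 in auto)
  have "F = randers_metric h \<omega> C"
    by (simp add: F_def randers_metric_def randers_norm_def hnorm_def fun_eq_iff)
  moreover have "chern_hessian F f x y y y < 0"
    by (rule hessian_neg[OF oS xC f xy xnz cov e]) (use near in \<open>simp_all add: pdh pdw\<close>)
  ultimately show ?thesis by simp
qed

theorem proposition2p8:
  fixes \<A> :: "('a::{t2_space,second_countable_topology}, 'n::finite) chart set"
    and h :: "('a, 'n) metric_field"
    and \<omega> :: "('a, 'n) covector_field"
    and K :: "'a set"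
    and m :: nat
    and X :: "nat \<Rightarrow> ('a, 'n) chart"
  assumes "randers_manifold \<A> h \<omega>"
    and "geodesically_asymptotically_flat \<A> h \<omega> K m X"
  shows "\<forall>\<^sub>F r\<^sub>0 in at_top.
    strongly_convex_boundary \<A> (randers_metric h \<omega>) (asymptotic_domain K m X r\<^sub>0)"
proof -
  have st: "smooth_structure \<A>" and h: "riemannian_metric \<A> h"
    using assms(1) unfolding randers_manifold_def by blast+
  have XA: "\<And>k. k \<in> {1..m} \<Longrightarrow> X k \<in> \<A>"
    and as: "\<And>k. k \<in> {1..m} \<Longrightarrow> asymptotic_chart h \<omega> (X k)"
    and ends: "- K = (\<Union>k\<in>{1..m}. fst (X k))" "disjoint_family_on (\<lambda>k. fst (X k)) {1..m}"
    using assms(2) unfolding geodesically_asymptotically_flat_def by blast+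
  define e where "e = 1 / (16 * real CARD('n) ^ 3)"
  have e: "e > 0" by (simp add: e_def)
  have N1: "real CARD('n) \<ge> 1" by (simp add: Suc_leI)
  have "real CARD('n) * real CARD('n) * e = 1 / (16 * real CARD('n))"
    by (simp add: e_def power3_eq_cube)
  also have "\<dots> \<le> 1/2" by (rule frac_le) (use N1 in linarith)+
  finally have e2: "real CARD('n) * real CARD('n) * e \<le> 1/2" .
  define good where "good k x \<longleftrightarrow> x \<in> snd (X k) ` fst (X k) \<and> (\<forall>i j l.
     \<bar>h (X k) x $ i $ j - (if i = j then 1 else 0)\<bar> \<le> e \<and>
     \<bar>pd l (\<lambda>x. h (X k) x $ i $ j) x\<bar> \<le> e / norm x \<and>
     \<bar>pd i (\<lambda>x. \<omega> (X k) x $ j) x - pd j (\<lambda>x. \<omega> (X k) x $ i) x\<bar> \<le> e / norm x)" for k x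
  have "\<forall>k\<in>{1..m}. \<forall>\<^sub>F x in at_infinity. good k x"
    unfolding good_def using asymptotic_chart_eventually[OF as e] by blast
  then have "\<forall>\<^sub>F x in at_infinity. \<forall>k\<in>{1..m}. good k x"
    by (intro eventually_ball_finite) auto
  then obtain R1 where R1: "\<And>x k. R1 \<le> norm x \<Longrightarrow> k \<in> {1..m} \<Longrightarrow> good k x"
    unfolding eventually_at_infinity by blast
  \<comment> \<open>The shift by one leaves room for the segments in \<open>end_far_part_closed\<close>.\<close>
  define R where "R = max R1 0 + 1"
  have near_id: "1/2 * (v \<bullet> v) \<le> v \<bullet> (h (X k) x *v v)" if "R1 \<le> norm x" "k \<in> {1..m}" for k x v
    using quadratic_form_near_identity(1)[of "h (X k) x" e v, OF _ e2] R1[OF that] unfolding good_def by blast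
  interpret exhausted_by_ends K m X R
  proof
    show "is_chart (X k)" if "k \<in> {1..m}" for k using atlas_chart[OF st XA[OF that]] .
    show "x \<in> snd (X k) ` fst (X k)" if "k \<in> {1..m}" "R \<le> norm x" for k x
    proof -
      have "R1 \<le> norm x" using that(2) by (simp add: R_def)
      from R1[OF this that(1)] show ?thesis by (simp add: good_def)
    qed
    show "closed {q \<in> fst (X k). r \<le> norm (snd (X k) q)}" if k: "k \<in> {1..m}" and r: "R \<le> r" for k r
    proof (rule end_far_part_closed[OF st h XA[OF k]])
      show "x \<in> snd (X k) ` fst (X k)" if "R1 \<le> norm x" for x
        using R1[OF that k] by (simp add: good_def)
      show "R1 + 1 \<le> r" using r by (simp add: R_def)
    qed (rule near_id[OF _ k])
  qed (use ends in \<open>auto simp: R_def\<close>)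
  have "strongly_convex_boundary \<A> (randers_metric h \<omega>) (asymptotic_domain K m X r)" if r: "R < r" for r
    unfolding strongly_convex_boundary_def
  proof (intro conjI ballI)
    have r0: "0 < r" using r R0 by linarith
    show "manifold_domain (asymptotic_domain K m X r)"
      unfolding manifold_domain_def using open_domain connected_domain r by auto
    let ?D = "asymptotic_domain K m X r"
    fix p assume "p \<in> frontier ?D"
    then obtain k where k: "k \<in> {1..m}" "p \<in> fst (X k)" and pr: "rad k p = r"
      unfolding frontier_domain[OF r] by blast
    define U where "U = fst (X k)"
    define \<phi> where "\<phi> q = r\<^sup>2 - (snd (X k) q) \<bullet> (snd (X k) q)" for q
    note ch = charts[OF k(1)]
    define S where "S = snd (X k) ` fst (X k)"
    have oS: "open S" using ch by (simp add: is_chart_def S_def)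
    have \<phi>: "(\<phi> \<circ> chart_inv (X k)) z = r\<^sup>2 - z \<bullet> z" if "z \<in> S" for z
      using chart_right[OF that[unfolded S_def] ch] by (simp add: \<phi>_def)
    have fr: "q \<in> frontier ?D \<longleftrightarrow> rad k q = r" if "q \<in> U" for q
    proof
      have q: "q \<in> fst (X k)" using that by (simp add: U_def)
      show "rad k q = r" if fq: "q \<in> frontier ?D"
      proof -
        obtain l where "l \<in> {1..m}" "q \<in> fst (X l)" "rad l q = r"
          using fq unfolding frontier_domain[OF r] by blast
        then show ?thesis using end_unique[OF _ k(1) _ q] by metis
      qed
      show "q \<in> frontier ?D" if "rad k q = r"
        unfolding frontier_domain[OF r] using k(1) q that by blast
    qed
    have dphi: "chart_differential (X k) \<phi> q = (\<lambda>v. - 2 * (snd (X k) q \<bullet> v))" if "q \<in> U" for q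
    proof -
      have "snd (X k) q \<in> S" using that by (simp add: U_def S_def)
      then have "frechet_derivative (\<phi> \<circ> chart_inv (X k)) (at (snd (X k) q))
          = frechet_derivative (\<lambda>z. r\<^sup>2 - z \<bullet> z) (at (snd (X k) q))"
        by (rule frechet_derivative_cong_open[OF oS]) (rule \<phi>)
      then show ?thesis unfolding chart_differential_def
        by (simp only: frechet_derivative_at[OF has_derivative_square_norm, symmetric])
    qed
    show "\<exists>U \<phi>. open U \<and> p \<in> U \<and> Ck_function 2 \<A> U \<phi> \<and>
        {q \<in> U. \<phi> q = 0} = U \<inter> frontier ?D \<and>
        (\<forall>q \<in> U \<inter> ?D. \<phi> q > 0) \<and>
        (\<forall>q \<in> U \<inter> frontier ?D. \<exists>C\<in>\<A>. q \<in> fst C \<and> (\<exists>v. chart_differential C \<phi> q v \<noteq> 0)) \<and>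
        (\<exists>C\<in>\<A>. p \<in> fst C \<and>
           (\<forall>y. y \<noteq> 0 \<and> chart_differential C \<phi> p y = 0 \<longrightarrow>
              chern_hessian (randers_metric h \<omega> C) (\<phi> \<circ> chart_inv C) (snd C p) y y y < 0))"
    proof (intro exI[of _ U] exI[of _ \<phi>] conjI)
      show "open U" using ch by (simp add: U_def is_chart_def)
      show "p \<in> U" using k by (simp add: U_def)
      have "Ck_on 2 (\<phi> \<circ> chart_inv (X k)) S"
        by (subst Ck_on_cong_open[OF oS, where g = "\<lambda>z. r\<^sup>2 - z \<bullet> z"]) (rule \<phi> Ck_on_square_norm; assumption?)+
      then show "Ck_function 2 \<A> U \<phi>"
        unfolding Ck_function_def using XA[OF k(1)] by (auto simp: U_def S_def)
      have "\<phi> q = 0 \<longleftrightarrow> rad k q = r" for q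
      proof -
        have "\<phi> q = 0 \<longleftrightarrow> r\<^sup>2 = (rad k q)\<^sup>2" by (simp add: \<phi>_def dot_square_norm)
        also have "\<dots> \<longleftrightarrow> rad k q = r" using r0 by (auto simp: power2_eq_iff_nonneg)
        finally show ?thesis .
      qed
      then show "{q \<in> U. \<phi> q = 0} = U \<inter> frontier ?D" using fr by blast
      show "\<forall>q \<in> U \<inter> ?D. \<phi> q > 0"
      proof
        fix q assume "q \<in> U \<inter> ?D"
        then have "rad k q < r" unfolding asymptotic_domain_eq[OF less_imp_le[OF r0]] U_def not_le[symmetric] using k(1) by blast
        then have "(rad k q)\<^sup>2 < r\<^sup>2" by (intro power_strict_mono) auto
        then show "\<phi> q > 0" by (simp add: \<phi>_def dot_square_norm)
      qed
      show "\<forall>q \<in> U \<inter> frontier ?D. \<exists>C\<in>\<A>. q \<in> fst C \<and> (\<exists>v. chart_differential C \<phi> q v \<noteq> 0)"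
      proof
        fix q assume q: "q \<in> U \<inter> frontier ?D"
        then have "snd (X k) q \<noteq> 0" using fr[of q] r0 by auto
        then have "chart_differential (X k) \<phi> q (snd (X k) q) \<noteq> 0" using q by (simp add: dphi)
        then show "\<exists>C\<in>\<A>. q \<in> fst C \<and> (\<exists>v. chart_differential C \<phi> q v \<noteq> 0)"
          using q XA[OF k(1)] unfolding U_def by blast
      qed
      have "R1 \<le> rad k p" using r by (simp add: R_def pr)
      from R1[OF this k(1)] have good: "good k (snd (X k) p)" .
      have "chern_hessian (randers_metric h \<omega> (X k)) (\<phi> \<circ> chart_inv (X k)) (snd (X k) p) y y y < 0"
        if "y \<noteq> 0" "chart_differential (X k) \<phi> p y = 0" for y
      proof (rule coordinate_sphere_hessian_neg[OF assms(1) XA[OF k(1)] _ _ e_def _ \<phi>[unfolded S_def] that(1)])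
        show "snd (X k) p \<in> snd (X k) ` fst (X k)" using k by blast
        show "snd (X k) p \<noteq> 0" using pr r0 by auto
        show "snd (X k) p \<bullet> y = 0" using that(2) dphi[of p] k by (simp add: U_def)
      qed (use good in \<open>simp_all add: good_def\<close>)
      then show "\<exists>C\<in>\<A>. p \<in> fst C \<and>
           (\<forall>y. y \<noteq> 0 \<and> chart_differential C \<phi> p y = 0 \<longrightarrow>
              chern_hessian (randers_metric h \<omega> C) (\<phi> \<circ> chart_inv C) (snd C p) y y y < 0)"
        using k XA by blast
    qed
  qed
  then show ?thesis by (rule eventually_mono[OF eventually_gt_at_top])
qed

end
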